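(* Let $R$ be a Noetherian ring and let $\mathcal{I} = \{I_m\}_{m \in \mathbb{N}}$ and $\mathcal{J} = \{J_m\}_{m \in \mathbb{N}}$ be filtrations of ideals in $R$. Then $\mathcal{I}$ and $\mathcal{J}$ are projectively equivalent if and only if there exist $\alpha, \beta \in \mathbb{R}_{>0}$ such that $\mathcal{IC}(\mathcal{I}^{(\alpha)}) = \mathcal{IC}(\mathcal{J}^{(\beta)})$, or equivalently, $\overline{R[\mathcal{I}^{(\alpha)}]} = \overline{R[\mathcal{J}^{(\beta)}]}$.
   Context: Rings are commutative with identity, and $\mathbb{N}$ denotes the nonnegative integers. A filtration of a ring $R$ is a family $\mathcal{I} = \{I_m\}_{m\in\mathbb{N}}$ of ideals of $R$ with $I_0 = R$, $I_n \supseteq I_{n+1}$ and $I_n I_m \subseteq I_{n+m}$ for all $m,n \in \mathbb{N}$. The order of $\mathcal{I}$ is $\nu_{\mathcal{I}}(f) = \sup\{m \mid f \in I_m\} \in \mathbb{N}\cup\{\infty\}$ for $f \in R$. The asymptotic Samuel function of $\mathcal{I}$ is $\overline{\nu}_{\mathcal{I}} : R \to \mathbb{R}_{\ge 0}\cup\{\infty\}$, $\overline{\nu}_{\mathcal{I}}(x) = \lim_{n\to\infty} \nu_{\mathcal{I}}(x^n)/n$ (this limit always exists in $\mathbb{R}_{\ge 0}\cup\{\infty\}$). Filtrations $\mathcal{I}$ and $\mathcal{J}$ of $R$ are projectively equivalent if there exists $\gamma \in \mathbb{R}_{>0}$ such that $\overline{\nu}_{\mathcal{I}} = \gamma\, \overline{\nu}_{\mathcal{J}}$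 as functions on $R$ (with $\gamma\cdot\infty = \infty$). For $\alpha \in \mathbb{R}_{>0}$, the twist of $\mathcal{I}$ by $\alpha$ is the filtration $\mathcal{I}^{(\alpha)} = \{I_{\lceil \alpha m\rceil}\}_{m\in\mathbb{N}}$. The Rees algebra of $\mathcal{I}$ is the graded $R$-algebra $R[\mathcal{I}] = \sum_{m\in\mathbb{N}} I_m t^m \subseteq R[t]$, where $R[t]$ is the polynomial ring, and $\overline{R[\mathcal{I}]}$ denotes the integral closure of $R[\mathcal{I}]$ in $R[t]$. The integral closure of the filtration $\mathcal{I}$ is the filtration $\mathcal{IC}(\mathcal{I}) = \{L_m\}_{m\in\mathbb{N}}$ where $L_m = \{f\in R \mid f^r \in \overline{I_{rm}} \text{ for some integer } r>0\}$ and $\overline{I_{rm}}$ is the integral closure of the ideal $I_{rm}$ in $R$; one has $\overline{R[\mathcal{I}]} = \sum_{m\in\mathbb{N}} L_m t^m$. *)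

theory Defs
  imports
    "HOL-Analysis.Analysis"
    "HOL-Algebra.Ideal_Product"
    "HOL-Algebra.Ring_Divisibility"
    "HOL-Algebra.UnivPoly"
begin

definition filtration :: "('a, 'b) ring_scheme \<Rightarrow> (nat \<Rightarrow> 'a set) \<Rightarrow> bool" where
  "filtration R I \<longleftrightarrow>
     (\<forall>m. ideal (I m) R) \<and>
     I 0 = carrier R \<and>
     (\<forall>n. I (Suc n) \<subseteq> I n) \<and>
     (\<forall>m n. I n \<cdot>\<^bsub>R\<^esub> I m \<subseteq> I (n + m))"

definition filt_order :: "(nat \<Rightarrow> 'a set) \<Rightarrow> 'a \<Rightarrow> enat" where
  "filt_order I f = (SUP m\<in>{m. f \<in> I m}. enat m)"

definition asymptotic_samuel ::
    "('a, 'b) ring_scheme \<Rightarrow> (nat \<Rightarrow> 'a set) \<Rightarrow> 'a \<Rightarrow> ennreal" where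
  "asymptotic_samuel R I x =
     lim (\<lambda>n. ennreal_of_enat (filt_order I (x [^]\<^bsub>R\<^esub> n)) / of_nat n)"

definition projectively_equivalent ::
    "('a, 'b) ring_scheme \<Rightarrow> (nat \<Rightarrow> 'a set) \<Rightarrow> (nat \<Rightarrow> 'a set) \<Rightarrow> bool" where
  "projectively_equivalent R I J \<longleftrightarrow>
     (\<exists>\<gamma>::real. \<gamma> > 0 \<and>
        (\<forall>x\<in>carrier R. asymptotic_samuel R I x = ennreal \<gamma> * asymptotic_samuel R J x))"

definition twist :: "(nat \<Rightarrow> 'a set) \<Rightarrow> real \<Rightarrow> nat \<Rightarrow> 'a set" where
  "twist I \<alpha> = (\<lambda>m. I (nat \<lceil>\<alpha> * real m\<rceil>))"

text \<open>
  The powers of an ideal are taken in the multiplicative monoid of ideals, so the power with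
  exponent 0 is the whole ring. The coefficient of \<open>f\<^sup>n\<^sup>-\<^sup>i\<close> in the equation of integral
  dependence lies in the \<open>i\<close>-th power of the ideal.
\<close>

definition ideal_integral_closure :: "('a, 'b) ring_scheme \<Rightarrow> 'a set \<Rightarrow> 'a set" where
  "ideal_integral_closure R I =
     {f \<in> carrier R. \<exists>n>(0::nat). \<exists>a. (\<forall>i\<in>{1..n}. a i \<in> I [^]\<^bsub>ideals_set R\<^esub> i) \<and>
        f [^]\<^bsub>R\<^esub> n \<oplus>\<^bsub>R\<^esub> (\<Oplus>\<^bsub>R\<^esub>i\<in>{1..n}. a i \<otimes>\<^bsub>R\<^esub> f [^]\<^bsub>R\<^esub> (n - i)) = \<zero>\<^bsub>R\<^esub>}"

definition filt_integral_closure ::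
    "('a, 'b) ring_scheme \<Rightarrow> (nat \<Rightarrow> 'a set) \<Rightarrow> nat \<Rightarrow> 'a set" where
  "filt_integral_closure R I =
     (\<lambda>m. {f \<in> carrier R. \<exists>r>(0::nat). f [^]\<^bsub>R\<^esub> r \<in> ideal_integral_closure R (I (r * m))})"

text \<open>
  The underlying set of the Rees algebra: all finite sums of terms \<open>a\<^sub>m t\<^sup>m\<close> with \<open>a\<^sub>m \<in> I\<^sub>m\<close>.
\<close>

definition rees_algebra ::
    "('a, 'b) ring_scheme \<Rightarrow> (nat \<Rightarrow> 'a set) \<Rightarrow> (nat \<Rightarrow> 'a) set" where
  "rees_algebra R I =
     {(\<Oplus>\<^bsub>UP R\<^esub>m\<in>{..n}. monom (UP R) (a m) m) | n a. \<forall>m. a m \<in> I m}"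

definition integral_closure_in :: "('c, 'd) ring_scheme \<Rightarrow> 'c set \<Rightarrow> 'c set" where
  "integral_closure_in B A =
     {x \<in> carrier B. \<exists>n>(0::nat). \<exists>a::nat \<Rightarrow> 'c. (\<forall>i<n. a i \<in> A) \<and>
        x [^]\<^bsub>B\<^esub> n \<oplus>\<^bsub>B\<^esub> (\<Oplus>\<^bsub>B\<^esub>i\<in>{..<n}. a i \<otimes>\<^bsub>B\<^esub> x [^]\<^bsub>B\<^esub> i) = \<zero>\<^bsub>B\<^esub>}"

end

theory Submission
  imports Defs "HOL-Algebra.Subrings"
begin

text \<open>
  The ideals \<open>L\<^sub>m\<close> of \<open>IC(I\<^bsup>(\<alpha>)\<^esup>)\<close> lie between \<open>{\<nu> > \<alpha>m}\<close> and \<open>{\<nu> \<ge> \<alpha>m}\<close>, where \<open>\<nu>\<close> is the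
  asymptotic Samuel function of \<open>I\<close>, so equality of the closures determines \<open>\<nu>\<close> up to a factor.
  Conversely, the sets \<open>{\<nu> > c}\<close> are ideals, and in a Noetherian ring this leaves only countably many
  finite values of \<open>\<nu>\<close>. Hence \<open>\<alpha>\<close> can be chosen such that no \<open>\<alpha>m\<close> with \<open>m \<ge> 1\<close> is a value; the two
  bounds for \<open>L\<^sub>m\<close> then coincide and depend on \<open>\<nu>\<close> only.

  The Rees algebra version rests on \<open>\<Sum> L\<^sub>m t\<^sup>m\<close> being the integral closure of the Rees algebra. That
  homogeneous components of an integral element \<open>F\<close> are integral follows from the Dedekind--Mertens
  lemma: for large \<open>e\<close>, the module spanned by the products of \<open>e\<close> components of \<open>F\<close> with a component of
  some \<open>F\<^sup>j\<close>, \<open>j < n\<close>, is stable under multiplication by the components of \<open>F\<close>.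
\<close>

text \<open>Equal asymptotic Samuel functions do not force equal integral closures, which is why the
  choice of \<alpha> matters. In k[x] over a field k let I_0 = k[x] and I_m = (x^(m+1)) for m \<ge>
  1: then \<nu>(x) = 1, as for the powers of (x), yet x is not in L_1. The discrepancy is confined
  to ties \<nu>(f) = \<alpha>m, so an \<alpha> without ties removes it; with \<nu>_I = \<gamma>
  \<nu>_J, the number \<beta> = \<alpha>/\<gamma> then has no ties for J. In the other direction the
  two bounds test \<nu> only at integer multiples of \<alpha>. Passing from x to its powers x^p
  makes all positive rational multiples available, and these are dense. The function \<nu> is
  handled through strict inequalities c < \<nu>(x) with c finite: each is witnessed by a single
  power x^n in some I_q with q > cn, so neither limits nor infinite values have to be carried
  along.\<close>

section \<open>Modules over a subring\<close>

text \<open>\<open>A\<close> is an arbitrary set rather than a subring, so that relations with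
  coefficients in a finite set can be expressed too. Building sums one term at a time avoids index
  sets; \<open>mspan_explicit\<close> recovers the indexed form.\<close>

inductive_set mspan :: "('a, 'b) ring_scheme \<Rightarrow> 'a set \<Rightarrow> 'a set \<Rightarrow> 'a set"
  for R (structure) and A X where
    zero: "\<zero> \<in> mspan R A X"
  | step: "\<lbrakk>a \<in> A; x \<in> X; s \<in> mspan R A X\<rbrakk> \<Longrightarrow> a \<otimes> x \<oplus> s \<in> mspan R A X"

lemma mspan_mono: "X \<subseteq> Y \<Longrightarrow> mspan R A X \<subseteq> mspan R A Y"
proof
  fix s assume "X \<subseteq> Y" "s \<in> mspan R A X"
  from this(2,1) show "s \<in> mspan R A Y"
    by (induction rule: mspan.induct) (auto intro: mspan.intros)
qed

context cring
begin

context
  fixes A :: "'a set" assumes A: "subring A R"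
begin

lemma mspan_closed: "X \<subseteq> carrier R \<Longrightarrow> s \<in> mspan R A X \<Longrightarrow> s \<in> carrier R"
  by (rotate_tac 1, induction rule: mspan.induct) (use subringE(1)[OF A] in auto)

lemma mspan_add:
  assumes X: "X \<subseteq> carrier R" and "s \<in> mspan R A X" "u \<in> mspan R A X"
  shows "s \<oplus> u \<in> mspan R A X"
  using assms(2)
proof (induction rule: mspan.induct)
  case zero
  then show ?case using mspan_closed[OF X assms(3)] assms(3) by simp
next
  case (step a x s)
  have "a \<in> carrier R" "x \<in> carrier R" "s \<in> carrier R" "u \<in> carrier R"
    using step X subringE(1)[OF A] mspan_closed[OF X] assms(3) by auto
  then have "a \<otimes> x \<oplus> s \<oplus> u = a \<otimes> x \<oplus> (s \<oplus> u)" by (simp add: a_assoc)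
  then show ?case using mspan.step[OF step(1,2,4)] by simp
qed

lemma mspan_smult:
  assumes X: "X \<subseteq> carrier R" and "s \<in> mspan R A X" "a \<in> A"
  shows "a \<otimes> s \<in> mspan R A X"
  using assms(2)
proof (induction rule: mspan.induct)
  case zero
  have "a \<in> carrier R" using subringE(1)[OF A] assms(3) by auto
  then show ?case by (simp add: mspan.zero)
next
  case (step b x s)
  have "a \<in> carrier R" "b \<in> carrier R" "x \<in> carrier R" "s \<in> carrier R"
    using step X subringE(1)[OF A] mspan_closed[OF X] assms(3) by auto
  then have "a \<otimes> (b \<otimes> x \<oplus> s) = (a \<otimes> b) \<otimes> x \<oplus> a \<otimes> s" by (simp add: r_distr m_assoc)
  then show ?case using mspan.step[OF _ step(2,4)] subringE(6)[OF A assms(3) step(1)] by simp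
qed

lemma mspan_incl:
  assumes X: "X \<subseteq> carrier R" and "x \<in> X"
  shows "x \<in> mspan R A X"
proof -
  have "\<one> \<otimes> x \<oplus> \<zero> \<in> mspan R A X"
    using subringE(3)[OF A] assms(2) mspan.zero by (rule mspan.step)
  moreover have "x \<in> carrier R" using assms by auto
  ultimately show ?thesis by simp
qed

lemma mspan_uminus:
  assumes X: "X \<subseteq> carrier R" and "s \<in> mspan R A X"
  shows "\<ominus> s \<in> mspan R A X"
  using mspan_smult[OF assms, of "\<ominus> \<one>"] subringE(3,5)[OF A] mspan_closed[OF assms]
  by (simp add: l_minus)

lemma mspan_minus:
  assumes "X \<subseteq> carrier R" and "s \<in> mspan R A X" "u \<in> mspan R A X"
  shows "s \<ominus> u \<in> mspan R A X"
  unfolding a_minus_def using assms by (simp add: mspan_add mspan_uminus)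

lemma mspan_finsum:
  assumes "X \<subseteq> carrier R" and "finite S" "\<And>i. i \<in> S \<Longrightarrow> f i \<in> mspan R A X"
  shows "finsum R f S \<in> mspan R A X"
  using assms(2,3)
proof (induction rule: finite_induct)
  case empty
  then show ?case by (simp add: mspan.zero)
next
  case (insert i S)
  then have "f i \<in> carrier R" "f \<in> S \<rightarrow> carrier R"
    using mspan_closed[OF assms(1)] by auto
  then have "finsum R f (insert i S) = f i \<oplus> finsum R f S" using insert by simp
  then show ?case using insert by (simp add: mspan_add[OF assms(1)])
qed

lemma mspan_least:
  assumes "Y \<subseteq> carrier R" "X \<subseteq> mspan R A Y" "s \<in> mspan R A X"
  shows "s \<in> mspan R A Y"
  using assms(3)
  by (induction rule: mspan.induct)
    (use assms(1,2) in \<open>auto intro!: mspan.zero mspan_add mspan_smult\<close>)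

lemma mspan_mult:
  assumes X: "X \<subseteq> carrier R" and Y: "Y \<subseteq> carrier R" and Z: "Z \<subseteq> carrier R"
    and XY: "\<And>x y. x \<in> X \<Longrightarrow> y \<in> Y \<Longrightarrow> x \<otimes> y \<in> mspan R A Z"
    and u: "u \<in> mspan R A X" and v: "v \<in> mspan R A Y"
  shows "u \<otimes> v \<in> mspan R A Z"
  using u
proof (induction rule: mspan.induct)
  case zero
  then show ?case using mspan_closed[OF Y v] by (simp add: mspan.zero)
next
  case (step a x s)
  have car: "a \<in> carrier R" "x \<in> carrier R" "s \<in> carrier R" "v \<in> carrier R"
    using step X subringE(1)[OF A] mspan_closed[OF X] mspan_closed[OF Y] v by auto
  have "x \<otimes> v \<in> mspan R A Z" using v
  proof (induction rule: mspan.induct)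
    case zero
    then show ?case using car by (simp add: mspan.zero)
  next
    case (step b y t)
    have c: "b \<in> carrier R" "y \<in> carrier R" "t \<in> carrier R"
      using step Y subringE(1)[OF A] mspan_closed[OF Y] by auto
    have "x \<otimes> (b \<otimes> y \<oplus> t) = b \<otimes> (x \<otimes> y) \<oplus> x \<otimes> t"
      using c car by (simp add: r_distr m_lcomm)
    moreover have "b \<otimes> (x \<otimes> y) \<in> mspan R A Z"
      using XY[OF \<open>x \<in> X\<close> step(2)] step(1) by (rule mspan_smult[OF Z])
    ultimately show ?case using step mspan_add[OF Z] by simp
  qed
  then have "a \<otimes> (x \<otimes> v) \<in> mspan R A Z" using step(1) by (rule mspan_smult[OF Z])
  then have "a \<otimes> (x \<otimes> v) \<oplus> s \<otimes> v \<in> mspan R A Z"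
    using step(4) by (rule mspan_add[OF Z])
  moreover have "(a \<otimes> x \<oplus> s) \<otimes> v = a \<otimes> (x \<otimes> v) \<oplus> s \<otimes> v"
    using car by (simp add: l_distr m_assoc)
  ultimately show ?case by simp
qed

lemma mspan_mult_left:
  assumes X: "X \<subseteq> carrier R" and Z: "Z \<subseteq> carrier R" and c: "c \<in> carrier R"
    and XY: "\<And>x. x \<in> X \<Longrightarrow> c \<otimes> x \<in> mspan R A Z"
    and u: "u \<in> mspan R A X"
  shows "c \<otimes> u \<in> mspan R A Z"
  using mspan_mult[of "{c}" X Z c u] assms mspan_incl[of "{c}" c] by auto

text \<open>Bridge to the indexed sums in equations of integral dependence. Adding a term changes a
  single coefficient, so coinciding values of \<open>f\<close> at different indices do no
  harm.\<close>

lemma mspan_explicit: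
  fixes f :: "nat \<Rightarrow> 'a"
  assumes f: "\<And>i. i < d \<Longrightarrow> f i \<in> carrier R"
  shows "s \<in> mspan R A (f ` {..<d}) \<longleftrightarrow>
    (\<exists>a. (\<forall>i<d. a i \<in> A) \<and> s = (\<Oplus>i\<in>{..<d}. a i \<otimes> f i))" (is "?l \<longleftrightarrow> ?r")
proof
  assume ?l
  then show ?r
  proof (induction rule: mspan.induct)
    case zero
    have "(\<Oplus>i\<in>{..<d}. \<zero> \<otimes> f i) = (\<Oplus>i\<in>{..<d}. \<zero>)"
      by (rule finsum_cong') (use f in auto)
    then show ?case using subringE(2)[OF A] by (intro exI[of _ "\<lambda>_. \<zero>"]) simp
  next
    case (step b x s)
    then obtain a j where a: "\<forall>i<d. a i \<in> A" "s = (\<Oplus>i\<in>{..<d}. a i \<otimes> f i)"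
      and j: "j < d" "x = f j" by auto
    have car: "\<And>i. i < d \<Longrightarrow> a i \<in> carrier R" "b \<in> carrier R"
      using a step subringE(1)[OF A] by auto
    have "b \<otimes> x \<oplus> s = (\<Oplus>i\<in>{..<d}. if j = i then b \<otimes> f i else \<zero>) \<oplus> s"
      using add.finprod_singleton[of j "{..<d}" "\<lambda>i. b \<otimes> f i"] car f j by simp
    also have "\<dots> = (\<Oplus>i\<in>{..<d}. (if j = i then b \<otimes> f i else \<zero>) \<oplus> a i \<otimes> f i)"
      unfolding a(2) by (rule finsum_addf[symmetric]) (use car f in auto)
    also have "\<dots> = (\<Oplus>i\<in>{..<d}. (if j = i then b \<oplus> a i else a i) \<otimes> f i)"
      by (rule finsum_cong') (use car f in \<open>auto simp: l_distr\<close>)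
    finally have "b \<otimes> x \<oplus> s = (\<Oplus>i\<in>{..<d}. (if j = i then b \<oplus> a i else a i) \<otimes> f i)" .
    then show ?case using a step(1) subringE(7)[OF A]
      by (intro exI[of _ "\<lambda>i. if j = i then b \<oplus> a i else a i"]) auto
  qed
next
  assume ?r
  then obtain a where a: "\<forall>i<d. a i \<in> A" "s = (\<Oplus>i\<in>{..<d}. a i \<otimes> f i)" by blast
  have X: "f ` {..<d} \<subseteq> carrier R" using f by auto
  show ?l unfolding a(2)
  proof (rule mspan_finsum[OF X])
    fix i assume "i \<in> {..<d}"
    then have "f i \<in> mspan R A (f ` {..<d})" "a i \<in> A" using a by (auto intro: mspan_incl[OF X])
    then show "a i \<otimes> f i \<in> mspan R A (f ` {..<d})" by (rule mspan_smult[OF X])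
  qed simp
qed

end
end

section \<open>Integral elements\<close>

definition integral_over :: "('a, 'b) ring_scheme \<Rightarrow> 'a set \<Rightarrow> 'a \<Rightarrow> bool" where
  "integral_over R A x \<longleftrightarrow> (\<exists>d::nat. x [^]\<^bsub>R\<^esub> d \<in> mspan R A ((\<lambda>i. x [^]\<^bsub>R\<^esub> i) ` {..<d}))"

definition finite_extension :: "('a, 'b) ring_scheme \<Rightarrow> 'a set \<Rightarrow> 'a set \<Rightarrow> bool" where
  "finite_extension R A W \<longleftrightarrow> subring W R \<and> A \<subseteq> W \<and>
     (\<exists>G. finite G \<and> G \<subseteq> carrier R \<and> W = mspan R A G)"

context cring
begin

text \<open>Separates the multiples of a generator that is about to be eliminated from the
  contribution of the remaining generators.\<close>

lemma mspan_Un_decomp: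
  assumes A: "subring A R" and X: "X \<subseteq> carrier R" and Y: "Y \<subseteq> carrier R"
    and s: "s \<in> mspan R A (X \<union> Y)"
  obtains u v where "u \<in> mspan R A X" "v \<in> mspan R A Y" "s = u \<oplus> v"
proof -
  have "\<exists>u\<in>mspan R A X. \<exists>v\<in>mspan R A Y. s = u \<oplus> v" using s
  proof (induction rule: mspan.induct)
    case zero
    have "\<zero> \<in> mspan R A X" "\<zero> \<in> mspan R A Y" "\<zero> = \<zero> \<oplus> \<zero>" by (auto intro: mspan.zero)
    then show ?case by blast
  next
    case (step a x s)
    then obtain u v where uv: "u \<in> mspan R A X" "v \<in> mspan R A Y" "s = u \<oplus> v" by blast
    have car: "a \<in> carrier R" "x \<in> carrier R" "u \<in> carrier R" "v \<in> carrier R"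
      using step uv X Y subringE(1)[OF A] mspan_closed[OF A X] mspan_closed[OF A Y] by auto
    show ?case
    proof (cases "x \<in> X")
      case True
      then have "a \<otimes> x \<oplus> u \<in> mspan R A X" using step uv by (intro mspan.step)
      moreover have "a \<otimes> x \<oplus> s = (a \<otimes> x \<oplus> u) \<oplus> v" using car uv by (simp add: a_assoc)
      ultimately show ?thesis using uv by blast
    next
      case False
      then have "a \<otimes> x \<oplus> v \<in> mspan R A Y" using step uv by (intro mspan.step) auto
      moreover have "a \<otimes> x \<oplus> s = u \<oplus> (a \<otimes> x \<oplus> v)" using car uv by (simp add: a_lcomm)
      ultimately show ?thesis using uv by blast
    qed
  qed
  then show thesis using that by blast
qed

lemma mspan_image_mult_decomp:
  assumes A: "subring A R" and X: "X \<subseteq> carrier R" and z: "z \<in> carrier R"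
    and s: "s \<in> mspan R A ((\<lambda>y. y \<otimes> z) ` X)"
  obtains l where "l \<in> mspan R A X" "s = l \<otimes> z"
proof -
  have "\<exists>l\<in>mspan R A X. s = l \<otimes> z" using s
  proof (induction rule: mspan.induct)
    case zero
    have "\<zero> \<in> mspan R A X" "\<zero> = \<zero> \<otimes> z" using z by (auto intro: mspan.zero)
    then show ?case by blast
  next
    case (step a x s)
    then obtain l y where ly: "l \<in> mspan R A X" "s = l \<otimes> z" "y \<in> X" "x = y \<otimes> z" by blast
    have car: "a \<in> carrier R" "y \<in> carrier R" "l \<in> carrier R"
      using step ly X subringE(1)[OF A] mspan_closed[OF A X] by auto
    have "a \<otimes> x \<oplus> s = (a \<otimes> y \<oplus> l) \<otimes> z" using ly car z by (simp add: l_distr m_assoc)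
    moreover have "a \<otimes> y \<oplus> l \<in> mspan R A X" using step ly by (intro mspan.step)
    ultimately show ?case by blast
  qed
  then show thesis using that by blast
qed

text \<open>A substitute for the determinant trick: the generators are eliminated one after the other
  by cross-multiplication, which doubles the degree bound \<open>d\<close> each time.\<close>

lemma mspan_elimination:
  assumes A: "subring A R" and x: "x \<in> carrier R" and "finite Y" "Y \<subseteq> carrier R"
    and z0: "z0 \<in> carrier R"
    and "\<And>y. y \<in> insert z0 Y \<Longrightarrow> x [^] (d::nat) \<otimes> y \<in>
      mspan R A {x [^] i \<otimes> y' | i y'. i < d \<and> y' \<in> insert z0 Y}"
  shows "\<exists>D. x [^] (D::nat) \<otimes> z0 \<in> mspan R A {x [^] i \<otimes> z0 | i. i < D}"
  using assms(3,4,6)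
proof (induction Y arbitrary: d rule: finite_induct)
  case empty
  then show ?case by (intro exI[of _ d]) (use empty(2)[of z0] in simp)
next
  case (insert z Y)
  \<comment> \<open>\<open>Lw e\<close> spans the polynomials in x of degree below \<open>e\<close>
    over \<open>A\<close>; \<open>LS e\<close> spans their products with the generators that survive
    the elimination of \<open>z\<close>.\<close>
  define Lw where "Lw e = (\<lambda>i. x [^] i) ` {..<e::nat}" for e
  define LS where "LS e = {x [^] i \<otimes> y' | i y'. i < (e::nat) \<and> y' \<in> insert z0 Y}" for e
  have z: "z \<in> carrier R" and Y: "insert z0 Y \<subseteq> carrier R" using insert z0 by auto
  have Lwc: "Lw e \<subseteq> carrier R" for e using x by (auto simp: Lw_def)
  have LSc: "LS e \<subseteq> carrier R" for e using x Y by (auto simp: LS_def)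
  have LSI: "x [^] i \<otimes> y \<in> LS e" if "i < e" "y \<in> insert z0 Y" for i e y
    unfolding LS_def using that by blast
  have decomp: "\<exists>l\<in>mspan R A (Lw d). \<exists>w\<in>mspan R A (LS d). x [^] d \<otimes> y = l \<otimes> z \<oplus> w"
    if "y \<in> insert z0 (insert z Y)" for y
  proof -
    have eq: "{x [^] i \<otimes> y' | i y'. i < d \<and> y' \<in> insert z0 (insert z Y)} =
      (\<lambda>y. y \<otimes> z) ` Lw d \<union> LS d"
      by (auto simp: Lw_def LS_def)
    have "x [^] d \<otimes> y \<in> mspan R A ((\<lambda>y. y \<otimes> z) ` Lw d \<union> LS d)"
      using insert.prems(2)[OF that] unfolding eq .
    moreover have "(\<lambda>y. y \<otimes> z) ` Lw d \<subseteq> carrier R" using Lwc z by auto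
    ultimately obtain u w where uw: "u \<in> mspan R A ((\<lambda>y. y \<otimes> z) ` Lw d)" "w \<in> mspan R A (LS d)"
      "x [^] d \<otimes> y = u \<oplus> w" using mspan_Un_decomp[OF A _ LSc] by metis
    obtain l where "l \<in> mspan R A (Lw d)" "u = l \<otimes> z"
      using mspan_image_mult_decomp[OF A Lwc z uw(1)] .
    then show ?thesis using uw by blast
  qed
  obtain l w where lw: "l \<in> mspan R A (Lw d)" "w \<in> mspan R A (LS d)"
    "x [^] d \<otimes> z = l \<otimes> z \<oplus> w" using decomp[of z] by blast
  have LL: "u \<otimes> v \<in> mspan R A (LS (2 * d))"
    if "u \<in> mspan R A (Lw d)" "v \<in> mspan R A (LS d)" for u v
  proof (rule mspan_mult[OF A Lwc LSc LSc _ that])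
    fix p q assume "p \<in> Lw d" "q \<in> LS d"
    then obtain i j y where ij: "i < d" "j < d" "y \<in> insert z0 Y" "p = x [^] i" "q = x [^] j \<otimes> y"
      by (auto simp: Lw_def LS_def)
    have "y \<in> carrier R" using ij Y by auto
    then have "p \<otimes> q = x [^] (i + j) \<otimes> y" using ij x by (simp add: nat_pow_mult[symmetric] m_assoc)
    moreover have "i + j < 2 * d" using ij by simp
    ultimately have "p \<otimes> q \<in> LS (2 * d)" using ij LSI by simp
    then show "p \<otimes> q \<in> mspan R A (LS (2 * d))" by (rule mspan_incl[OF A LSc])
  qed
  have xL: "x [^] d \<otimes> v \<in> mspan R A (LS (2 * d))" if "v \<in> mspan R A (LS d)" for v
  proof (rule mspan_mult_left[OF A LSc LSc _ _ that])
    fix q assume "q \<in> LS d"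
    then obtain j y where ij: "j < d" "y \<in> insert z0 Y" "q = x [^] j \<otimes> y"
      by (auto simp: LS_def)
    have "y \<in> carrier R" using ij Y by auto
    then have "x [^] d \<otimes> q = x [^] (d + j) \<otimes> y" using ij x by (simp add: nat_pow_mult[symmetric] m_assoc)
    moreover have "d + j < 2 * d" using ij by simp
    ultimately have "x [^] d \<otimes> q \<in> LS (2 * d)" using ij LSI by simp
    then show "x [^] d \<otimes> q \<in> mspan R A (LS (2 * d))" by (rule mspan_incl[OF A LSc])
  qed (use x in simp)
  show ?case
  proof (rule insert.IH)
    show "Y \<subseteq> carrier R" using Y by simp
    fix y assume y: "y \<in> insert z0 Y"
    then obtain l' w' where lw': "l' \<in> mspan R A (Lw d)" "w' \<in> mspan R A (LS d)"
      "x [^] d \<otimes> y = l' \<otimes> z \<oplus> w'" using decomp[of y] by blast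
    have car: "l \<in> carrier R" "l' \<in> carrier R" "w \<in> carrier R" "w' \<in> carrier R"
        "y \<in> carrier R" "x [^] d \<in> carrier R"
      using lw lw' mspan_closed[OF A Lwc] mspan_closed[OF A LSc] y Y x by auto
    have yL: "y \<in> insert z0 Y \<Longrightarrow> l \<otimes> (x [^] d \<otimes> y) \<in> mspan R A (LS (2 * d))"
      for y
    proof (rule mspan_mult[OF A Lwc _ LSc _ lw(1), where Y = "{x [^] d \<otimes> y}"])
      assume y: "y \<in> insert z0 Y"
      then have yc: "y \<in> carrier R" using Y by auto
      then show "{x [^] d \<otimes> y} \<subseteq> carrier R" using x by simp
      then show "x [^] d \<otimes> y \<in> mspan R A {x [^] d \<otimes> y}" by (rule mspan_incl[OF A]) simp
      fix p q assume "p \<in> Lw d" "q \<in> {x [^] d \<otimes> y}"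
      then obtain i where i: "i < d" "p = x [^] i" "q = x [^] d \<otimes> y" by (auto simp: Lw_def)
      then have "p \<otimes> q = x [^] (i + d) \<otimes> y" using x yc by (simp add: nat_pow_mult[symmetric] m_assoc)
      moreover have "i + d < 2 * d" using i by simp
      ultimately have "p \<otimes> q \<in> LS (2 * d)" using y LSI by simp
      then show "p \<otimes> q \<in> mspan R A (LS (2 * d))" by (rule mspan_incl[OF A LSc])
    qed
    have w: "w = x [^] d \<otimes> z \<ominus> l \<otimes> z"
      using lw(3) car z by (simp add: a_minus_def a_ac r_neg r_neg1 r_neg2)
    \<comment> \<open>From x^d z = l z + w and x^d y = l' z + w' one gets (x^d - l)(x^d y - w') = l'
      w, which is free of z. The leading term is still the pure power x^(2d), so nothing has to be
      divided, and all other terms have degree below 2d.\<close>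
    have "x [^] (2 * d) \<otimes> y = x [^] d \<otimes> (x [^] d \<otimes> y)"
      using x car by (simp add: nat_pow_mult[symmetric] m_assoc mult_2)
    also have "\<dots> = x [^] d \<otimes> (l' \<otimes> z) \<oplus> x [^] d \<otimes> w'"
      unfolding lw'(3) using car z by (simp add: r_distr)
    also have "x [^] d \<otimes> (l' \<otimes> z) = l' \<otimes> (x [^] d \<otimes> z)" using car z by (simp add: m_lcomm)
    also have "l' \<otimes> (x [^] d \<otimes> z) = l \<otimes> (l' \<otimes> z) \<oplus> l' \<otimes> w"
      unfolding lw(3) using car z by (simp add: r_distr m_lcomm)
    also have "l' \<otimes> z = x [^] d \<otimes> y \<ominus> w'"
      using lw'(3) car z by (simp add: a_minus_def a_assoc r_neg)
    also have "l \<otimes> (x [^] d \<otimes> y \<ominus> w') = l \<otimes> (x [^] d \<otimes> y) \<ominus> l \<otimes> w'"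
      using car by (simp add: a_minus_def r_distr r_minus)
    finally have eq: "x [^] (2 * d) \<otimes> y =
      l \<otimes> (x [^] d \<otimes> y) \<ominus> l \<otimes> w' \<oplus> l' \<otimes> w \<oplus> x [^] d \<otimes> w'" .
    have "l \<otimes> (x [^] d \<otimes> y) \<ominus> l \<otimes> w' \<oplus> l' \<otimes> w \<oplus> x [^] d \<otimes> w' \<in> mspan R A (LS (2 * d))"
      using yL[OF y] LL[OF lw(1) lw'(2)] LL[OF lw'(1) lw(2)] xL[OF lw'(2)]
      by (intro mspan_add[OF A LSc] mspan_minus[OF A LSc])
    then show "x [^] (2 * d) \<otimes> y \<in>
        mspan R A {x [^] i \<otimes> y' | i y'. i < 2 * d \<and> y' \<in> insert z0 Y}"
      unfolding eq LS_def .
  qed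
qed

text \<open>Stability under multiplication by x is the hypothesis of the elimination with d = 1. The
  element z joins the generators and is the one that survives; if z is a power of x, for instance 1,
  the relation becomes an equation of integral dependence.\<close>

lemma stable_module_relation:
  assumes A: "subring A R" and x: "x \<in> carrier R" and G: "finite G" "G \<subseteq> carrier R"
    and stable: "\<And>g. g \<in> G \<Longrightarrow> x \<otimes> g \<in> mspan R A G" and z: "z \<in> mspan R A G"
  shows "\<exists>D. x [^] (D::nat) \<otimes> z \<in> mspan R A {x [^] i \<otimes> z | i. i < D}"
proof (rule mspan_elimination[OF A x G])
  show zc: "z \<in> carrier R" using z by (rule mspan_closed[OF A G(2)])
  have Z: "{x [^] i \<otimes> y' |i y'. i < (1::nat) \<and> y' \<in> insert z G} = insert z G"
  proof -
    have "x [^] i \<otimes> y' = y'" if "i < (1::nat)" "y' \<in> insert z G" for i y'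
      using that zc G by auto
    note e = this
    show ?thesis
    proof (intro equalityI subsetI)
      fix y assume y: "y \<in> insert z G"
      have "x [^] (0::nat) \<otimes> y = y" using e[OF _ y] by simp
      then show "y \<in> {x [^] i \<otimes> y' |i y'. i < (1::nat) \<and> y' \<in> insert z G}"
        using y by (metis (mono_tags, lifting) mem_Collect_eq zero_less_one)
    qed (use e in auto)
  qed
  have "x \<otimes> y \<in> mspan R A G" if "y \<in> mspan R A G" for y
    using stable by (rule mspan_mult_left[OF A G(2) G(2) x _ that])
  then have "x \<otimes> y \<in> mspan R A (insert z G)" if "y \<in> insert z G" for y
    using that z mspan_mono[of G "insert z G" R A] mspan_incl[OF A G(2)] by auto
  then show "x [^] (1::nat) \<otimes> y \<in> mspan R A {x [^] i \<otimes> y' |i y'. i < (1::nat) \<and> y' \<in> insert z G}"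
    if "y \<in> insert z G" for y
    unfolding Z using that x by simp
qed

lemma integral_over_finite_extension:
  assumes A: "subring A R" and W: "finite_extension R A W" and x: "x \<in> W"
  shows "integral_over R A x"
proof -
  obtain G where G: "finite G" "G \<subseteq> carrier R" "W = mspan R A G" and sW: "subring W R"
    using W unfolding finite_extension_def by blast
  have xc: "x \<in> carrier R" using x subringE(1)[OF sW] by auto
  have "\<exists>D. x [^] (D::nat) \<otimes> \<one> \<in> mspan R A {x [^] i \<otimes> \<one> | i. i < D}"
  proof (rule stable_module_relation[OF A xc G(1,2)])
    show "\<one> \<in> mspan R A G" using subringE(3)[OF sW] G by simp
    fix g assume "g \<in> G"
    then have "g \<in> W" using mspan_incl[OF A G(2)] G(3) by simp
    then show "x \<otimes> g \<in> mspan R A G" using subringE(6)[OF sW x] G(3) by simp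
  qed
  moreover have "{x [^] i \<otimes> \<one> | i. i < D} = (\<lambda>i. x [^] i) ` {..<D}" for D :: nat
    using xc by auto
  ultimately show ?thesis using xc by (simp add: integral_over_def)
qed

section \<open>Finite extensions and transitivity of integral dependence\<close>

lemma finite_extension_refl:
  assumes A: "subring A R"
  shows "finite_extension R A A"
proof -
  have "mspan R A {\<one>} \<subseteq> A"
  proof
    fix s assume "s \<in> mspan R A {\<one>}"
    then show "s \<in> A" by (induction rule: mspan.induct) (use subringE[OF A] in auto)
  qed
  moreover have "A \<subseteq> mspan R A {\<one>}"
  proof
    fix a assume a: "a \<in> A"
    have "\<one> \<in> mspan R A {\<one>}" by (rule mspan_incl[OF A]) auto
    then have "a \<otimes> \<one> \<in> mspan R A {\<one>}" using a by (intro mspan_smult[OF A]) auto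
    then show "a \<in> mspan R A {\<one>}" using a subringE(1)[OF A] by auto
  qed
  ultimately show ?thesis using A unfolding finite_extension_def
    by (intro conjI exI[of _ "{\<one>}"]) auto
qed

text \<open>\<open>W'\<close> is W[x]. An equation of degree d reduces every power of x to powers
  below d, and the products of generators of W over A with powers of x generate W[x] over A.\<close>

lemma finite_extension_adjoin:
  assumes A: "subring A R" and W: "finite_extension R A W" and x: "x \<in> carrier R"
    and int: "integral_over R W x"
  obtains W' where "finite_extension R A W'" "W \<subseteq> W'" "x \<in> W'"
proof -
  obtain G where G: "finite G" "G \<subseteq> carrier R" "W = mspan R A G" and sW: "subring W R"
    and AW: "A \<subseteq> W"
    using W unfolding finite_extension_def by blast
  obtain d where d: "x [^] (d::nat) \<in> mspan R W ((\<lambda>i. x [^] i) ` {..<d})"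
    using int unfolding integral_over_def by blast
  define X where "X = (\<lambda>i. x [^] i) ` {..<Suc d}"
  define W' where "W' = mspan R W X"
  have Xc: "X \<subseteq> carrier R" using x by (auto simp: X_def)
  have pow: "x [^] n \<in> mspan R W ((\<lambda>i. x [^] i) ` {..<d})" for n :: nat
  proof (induction n)
    case 0
    show ?case
    proof (cases "d = 0")
      case True
      then show ?thesis using d by simp
    next
      case False
      then have "x [^] (0::nat) \<in> (\<lambda>i. x [^] i) ` {..<d}" by blast
      then show ?thesis by (rule mspan_incl[OF sW, rotated]) (use x in auto)
    qed
  next
    case (Suc n)
    have "x \<otimes> x [^] n \<in> mspan R W ((\<lambda>i. x [^] i) ` {..<d})"
    proof (rule mspan_mult_left[OF sW _ _ x _ Suc])
      fix y assume "y \<in> (\<lambda>i. x [^] i) ` {..<d}"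
      then obtain i where i: "i < d" "y = x [^] i" by auto
      have xy: "x \<otimes> y = x [^] Suc i" using x i by (simp add: m_comm)
      show "x \<otimes> y \<in> mspan R W ((\<lambda>i. x [^] i) ` {..<d})"
      proof (cases "Suc i = d")
        case True then show ?thesis using d xy by simp
      next
        case False
        then have "x \<otimes> y \<in> (\<lambda>i. x [^] i) ` {..<d}"
          unfolding xy using i by (intro imageI) auto
        then show ?thesis by (rule mspan_incl[OF sW, rotated]) (use x in auto)
      qed
    qed (use x in auto)
    then show ?case using x by (simp add: m_comm)
  qed
  have powW: "x [^] n \<in> W'" for n :: nat
  proof -
    have "(\<lambda>i. x [^] i) ` {..<d} \<subseteq> X" unfolding X_def by (intro image_mono) auto
    then show ?thesis using pow[of n] mspan_mono unfolding W'_def by blast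
  qed
  have sub: "subring W' R"
  proof (rule subringI)
    show "W' \<subseteq> carrier R" unfolding W'_def using mspan_closed[OF sW Xc] by auto
    show "\<one> \<in> W'" using powW[of 0] by simp
    show "\<ominus> h \<in> W'" if "h \<in> W'" for h using that mspan_uminus[OF sW Xc] by (simp add: W'_def)
    show "h \<oplus> k \<in> W'" if "h \<in> W'" "k \<in> W'" for h k
      using that mspan_add[OF sW Xc] by (simp add: W'_def)
    show "h \<otimes> k \<in> W'" if "h \<in> W'" "k \<in> W'" for h k
      using that unfolding W'_def
    proof (rule mspan_mult[OF sW Xc Xc Xc, rotated])
      fix y z assume "y \<in> X" "z \<in> X"
      then obtain i j where "y = x [^] (i::nat)" "z = x [^] (j::nat)" by (auto simp: X_def)
      then have "y \<otimes> z = x [^] (i + j)" using x by (simp add: nat_pow_mult)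
      then show "y \<otimes> z \<in> mspan R W X" using powW[of "i + j"] by (simp add: W'_def)
    qed
  qed
  have WW: "W \<subseteq> W'"
  proof
    fix w assume w: "w \<in> W"
    have "w \<otimes> x [^] (0::nat) \<in> W'"
      using powW[of 0] w unfolding W'_def by (intro mspan_smult[OF sW Xc])
    then show "w \<in> W'" using w subringE(1)[OF sW] by auto
  qed
  define Z where "Z = (\<lambda>(g, y). g \<otimes> y) ` (G \<times> X)"
  have Zc: "Z \<subseteq> carrier R" using G Xc by (auto simp: Z_def)
  have "W' = mspan R A Z"
  proof (intro equalityI subsetI)
    fix s assume "s \<in> W'"
    then show "s \<in> mspan R A Z" unfolding W'_def
    proof (induction rule: mspan.induct)
      case (step w y s)
      have "w \<otimes> y \<in> mspan R A Z"
      proof (rule mspan_mult[OF A G(2) Xc Zc])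
        show "w \<in> mspan R A G" using step G by simp
        show "y \<in> mspan R A X" using step by (intro mspan_incl[OF A Xc])
        show "g \<otimes> y \<in> mspan R A Z" if "g \<in> G" "y \<in> X" for g y
          using that by (intro mspan_incl[OF A Zc]) (auto simp: Z_def)
      qed
      then show ?case using step by (intro mspan_add[OF A Zc])
    qed (rule mspan.zero)
  next
    fix s assume "s \<in> mspan R A Z"
    then show "s \<in> W'"
    proof (induction rule: mspan.induct)
      case zero
      then show ?case using subringE(2)[OF sub] .
    next
      case (step a z s)
      obtain g y where "z = g \<otimes> y" "g \<in> G" "y \<in> X" using step by (auto simp: Z_def)
      moreover from this have "g \<in> W'" using mspan_incl[OF A G(2)] G(3) WW by auto
      moreover from \<open>y \<in> X\<close> have "y \<in> W'" unfolding W'_def by (rule mspan_incl[OF sW Xc])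
      ultimately have "z \<in> W'" using subringE(6)[OF sub] by simp
      then show ?case using step AW WW subringE(6,7)[OF sub] by (simp add: subset_iff)
    qed
  qed
  moreover have "finite Z" using G by (simp add: Z_def X_def)
  ultimately have "finite_extension R A W'" unfolding finite_extension_def
    using sub AW WW Zc by blast
  then show thesis using that[of W'] WW powW[of 1] x by simp
qed

lemma integral_over_mono:
  assumes "A \<subseteq> B" "integral_over R A x"
  shows "integral_over R B x"
proof -
  have "s \<in> mspan R B X" if "s \<in> mspan R A X" for s X
    using that by (induction rule: mspan.induct) (use assms(1) in \<open>auto intro: mspan.intros\<close>)
  then show ?thesis using assms(2) unfolding integral_over_def by blast
qed

lemma finite_extension_subring: "finite_extension R A W \<Longrightarrow> subring W R"
  and finite_extension_subset: "finite_extension R A W \<Longrightarrow> A \<subseteq> W"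
  by (auto simp: finite_extension_def)

lemma finite_extension_adjoin_finite:
  assumes A: "subring A R" and W: "finite_extension R A W" and "finite Y" "Y \<subseteq> carrier R"
    and "\<And>y. y \<in> Y \<Longrightarrow> integral_over R A y"
  shows "\<exists>W'. finite_extension R A W' \<and> W \<subseteq> W' \<and> Y \<subseteq> W'"
  using assms(3-)
proof (induction Y rule: finite_induct)
  case empty
  then show ?case using W by auto
next
  case (insert y Y)
  then obtain W1 where W1: "finite_extension R A W1" "W \<subseteq> W1" "Y \<subseteq> W1" by auto
  have "integral_over R W1 y"
    using integral_over_mono[OF finite_extension_subset[OF W1(1)]] insert.prems(2) by auto
  then obtain W2 where "finite_extension R A W2" "W1 \<subseteq> W2" "y \<in> W2"
    using finite_extension_adjoin[OF A W1(1)] insert.prems(1) by auto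
  then show ?case using W1 by auto
qed

lemma integral_over_add:
  assumes A: "subring A R" and "x \<in> carrier R" "y \<in> carrier R"
    and "integral_over R A x" "integral_over R A y"
  shows "integral_over R A (x \<oplus> y)"
proof -
  obtain W where W: "finite_extension R A W" "{x, y} \<subseteq> W"
    using finite_extension_adjoin_finite[OF A finite_extension_refl[OF A], of "{x, y}"] assms by auto
  then have "x \<oplus> y \<in> W" using subringE(7)[OF finite_extension_subring] by blast
  then show ?thesis by (rule integral_over_finite_extension[OF A W(1)])
qed

text \<open>Transitivity: the coefficients of the relation come from a finite set of integral
  elements, hence lie in one finite extension, to which x can be adjoined. The result is stated for
  a power of x because \<open>integral_over_monom_only_if\<close> uses it in this form.\<close>

lemma integral_over_pow_trans:
  assumes A: "subring A R" and Y: "finite Y" "Y \<subseteq> carrier R"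
    and "\<And>y. y \<in> Y \<Longrightarrow> integral_over R A y" and x: "x \<in> carrier R"
    and rel: "x [^] (d::nat) \<in> mspan R Y ((\<lambda>i. x [^] i) ` {..<d})"
  shows "integral_over R A (x [^] (r::nat))"
proof -
  obtain W where W: "finite_extension R A W" "Y \<subseteq> W"
    using finite_extension_adjoin_finite[OF A finite_extension_refl[OF A] Y] assms(4) by auto
  have "integral_over R Y x" using rel unfolding integral_over_def by blast
  then have "integral_over R W x" by (rule integral_over_mono[OF W(2)])
  then obtain W' where W': "finite_extension R A W'" "x \<in> W'"
    by (rule finite_extension_adjoin[OF A W(1) x])
  have "x [^] r \<in> W'"
    by (induction r) (use subringE(3,6)[OF finite_extension_subring[OF W'(1)]] W'(2) in auto)
  then show ?thesis by (rule integral_over_finite_extension[OF A W'(1)])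
qed

lemma integral_over_root:
  assumes A: "subring A R" and y: "y \<in> carrier R" and n: "n > (0::nat)" and yn: "y [^] n \<in> A"
  shows "integral_over R A y"
proof -
  have Xc: "(\<lambda>i. y [^] i) ` {..<n::nat} \<subseteq> carrier R" using y by auto
  have "y [^] (0::nat) \<in> (\<lambda>i. y [^] i) ` {..<n}" using n by blast
  then have "y [^] n \<otimes> y [^] (0::nat) \<in> mspan R A ((\<lambda>i. y [^] i) ` {..<n})"
    by (intro mspan_smult[OF A Xc] mspan_incl[OF A Xc] yn)
  then show ?thesis using y unfolding integral_over_def by auto
qed

lemma integral_closure_in_iff:
  assumes A: "subring A R"
  shows "x \<in> integral_closure_in R A \<longleftrightarrow> x \<in> carrier R \<and> integral_over R A x"
proof safe
  assume "x \<in> integral_closure_in R A"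
  then obtain n and a :: "nat \<Rightarrow> 'a" where x: "x \<in> carrier R" and n: "n > 0" and
    a: "\<forall>i<n. a i \<in> A" and eq: "x [^] n \<oplus> (\<Oplus>i\<in>{..<n}. a i \<otimes> x [^] i) = \<zero>"
    unfolding integral_closure_in_def by blast
  show "x \<in> carrier R" by fact
  have Xc: "(\<lambda>i. x [^] i) ` {..<n} \<subseteq> carrier R" using x by auto
  have "(\<Oplus>i\<in>{..<n}. a i \<otimes> x [^] i) \<in> mspan R A ((\<lambda>i. x [^] i) ` {..<n})"
    by (rule mspan_explicit[OF A, THEN iffD2]) (use a x in auto)
  moreover from this have "x [^] n = \<ominus> (\<Oplus>i\<in>{..<n}. a i \<otimes> x [^] i)"
    using eq x mspan_closed[OF A Xc] by (intro sum_zero_eq_neg) auto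
  ultimately have "x [^] n \<in> mspan R A ((\<lambda>i. x [^] i) ` {..<n})"
    using mspan_uminus[OF A Xc] by simp
  then show "integral_over R A x" unfolding integral_over_def by blast
next
  assume x: "x \<in> carrier R" and "integral_over R A x"
  then obtain d where d: "x [^] (d::nat) \<in> mspan R A ((\<lambda>i. x [^] i) ` {..<d})"
    unfolding integral_over_def by blast
  have "\<exists>d>0. x [^] (d::nat) \<in> mspan R A ((\<lambda>i. x [^] i) ` {..<d})"
  proof (cases "d = 0")
    case True
    \<comment> \<open>Degree 0 occurs only in the zero ring, where x = 0 is an equation of degree
      1.\<close>
    then have "\<one> \<in> mspan R A {}" using d by simp
    then have "\<one> = \<zero>" by cases auto
    then have "x [^] (1::nat) = \<zero>" using x by (metis nat_pow_eone r_null r_one zero_closed)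
    then show ?thesis by (intro exI[of _ 1]) (simp add: mspan.zero)
  qed (use d in auto)
  then obtain d where d: "d > 0" "x [^] (d::nat) \<in> mspan R A ((\<lambda>i. x [^] i) ` {..<d})" by blast
  have Xc: "(\<lambda>i. x [^] i) ` {..<d} \<subseteq> carrier R" using x by auto
  have "\<ominus> (x [^] d) \<in> mspan R A ((\<lambda>i. x [^] i) ` {..<d})" using d mspan_uminus[OF A Xc] by auto
  then obtain a where "\<forall>i<d. a i \<in> A" "\<ominus> (x [^] d) = (\<Oplus>i\<in>{..<d}. a i \<otimes> x [^] i)"
    using mspan_explicit[OF A, of d "\<lambda>i. x [^] i" "\<ominus> (x [^] d)"] x nat_pow_closed by metis
  moreover from this(2) have "x [^] d \<oplus> (\<Oplus>i\<in>{..<d}. a i \<otimes> x [^] i) = \<zero>"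
    using x by (metis nat_pow_closed r_neg)
  ultimately show "x \<in> integral_closure_in R A"
    unfolding integral_closure_in_def using x d by blast
qed

end

section \<open>The Dedekind--Mertens lemma\<close>

text \<open>Generators of the power of a content module: products of exactly k elements of
  \<open>C\<close>, not sums of such products.\<close>

primrec set_power :: "('a, 'b) ring_scheme \<Rightarrow> 'a set \<Rightarrow> nat \<Rightarrow> 'a set" where
  "set_power R C 0 = {\<one>\<^bsub>R\<^esub>}"
| "set_power R C (Suc k) = set_power R C k <#>\<^bsub>R\<^esub> C"

text \<open>Coefficients of a product of two polynomials given by their coefficient sequences. In
  the application the ring is itself a polynomial ring and the sequences list homogeneous
  components.\<close>

definition conv :: "('a, 'b) ring_scheme \<Rightarrow> (nat \<Rightarrow> 'a) \<Rightarrow> (nat \<Rightarrow> 'a) \<Rightarrow> nat \<Rightarrow> 'a" where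
  "conv R a b k = (\<Oplus>\<^bsub>R\<^esub>i\<in>{..k}. a i \<otimes>\<^bsub>R\<^esub> b (k - i))"

context cring
begin

lemma set_mult_carrier: "X \<subseteq> carrier R \<Longrightarrow> Y \<subseteq> carrier R \<Longrightarrow> X <#> Y \<subseteq> carrier R"
  by (auto simp: set_mult_def subset_iff)

lemma set_multI: "x \<in> X \<Longrightarrow> y \<in> Y \<Longrightarrow> x \<otimes> y \<in> X <#> Y"
  by (auto simp: set_mult_def)

lemma set_power_carrier: "C \<subseteq> carrier R \<Longrightarrow> set_power R C k \<subseteq> carrier R"
  by (induction k) (simp_all add: set_mult_carrier)

lemma finite_set_power: "finite C \<Longrightarrow> finite (set_power R C k)"
  by (induction k) (simp_all add: set_mult_def)

lemma pow_in_set_power: "x \<in> C \<Longrightarrow> x [^] k \<in> set_power R C k"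
  by (induction k) (simp_all add: set_multI)

lemma conv_closed: "(\<And>i. a i \<in> carrier R) \<Longrightarrow> (\<And>i. b i \<in> carrier R) \<Longrightarrow> conv R a b k \<in> carrier R"
  unfolding conv_def by (intro finsum_closed) auto

text \<open>Splits the product along the top coefficient of \<open>b\<close>, for the induction step
  of the Dedekind--Mertens lemma. The guard \<open>Q \<le> k\<close> makes the truncated difference
  \<open>k - Q\<close> harmless.\<close>

lemma conv_truncate:
  assumes a: "\<And>i. a i \<in> carrier R" and b: "\<And>i. b i \<in> carrier R"
    and bQ: "\<And>j. j > Q \<Longrightarrow> b j = \<zero>"
  shows "conv R a b k = conv R a (\<lambda>j. if j < Q then b j else \<zero>) k \<oplus>
    (if Q \<le> k then a (k - Q) \<otimes> b Q else \<zero>)" (is "_ = conv R a ?b k \<oplus> ?e")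
proof -
  have e: "?e = (\<Oplus>i\<in>{..k}. if k - Q = i then (if Q \<le> k then a i \<otimes> b Q else \<zero>) else \<zero>)"
    using add.finprod_singleton[of "k - Q" "{..k}" "\<lambda>i. if Q \<le> k then a i \<otimes> b Q else \<zero>"] a b
    by simp
  have "conv R a ?b k \<oplus> ?e = (\<Oplus>i\<in>{..k}. a i \<otimes> ?b (k - i) \<oplus>
      (if k - Q = i then (if Q \<le> k then a i \<otimes> b Q else \<zero>) else \<zero>))"
    unfolding conv_def e by (rule finsum_addf[symmetric]) (use a b in auto)
  also have "\<dots> = (\<Oplus>i\<in>{..k}. a i \<otimes> b (k - i))"
  proof (rule finsum_cong')
    fix i assume "i \<in> {..k}"
    then consider "k - i < Q" | "k - i = Q" | "k - i > Q" by linarith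
    then show "a i \<otimes> ?b (k - i) \<oplus>
      (if k - Q = i then (if Q \<le> k then a i \<otimes> b Q else \<zero>) else \<zero>) = a i \<otimes> b (k - i)"
      using \<open>i \<in> {..k}\<close> a b bQ[of "k - i"] by cases auto
  qed (use a b in auto)
  finally show ?thesis by (simp add: conv_def)
qed

text \<open>The nontrivial inclusion in c(a)^(n+1) c(b) = c(a)^n c(ab), where c is the content.
  \<open>Q\<close> bounds the number of coefficients of b, not its degree, so the exponent is one
  above the sharp one and the induction starts at b = 0. The induction on \<open>Q\<close> removes
  the top coefficient b_Q; the products with a_i b_Q are reached by descending induction on
  i.\<close>

lemma dedekind_mertens:
  assumes A: "subring A R" and a: "\<And>i. a i \<in> carrier R" and ap: "\<And>i. i \<ge> p \<Longrightarrow> a i = \<zero>"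
    and "\<And>i. b i \<in> carrier R" and "\<And>j. j \<ge> Q \<Longrightarrow> b j = \<zero>"
    and "s \<in> mspan R A (set_power R (range a) (Suc Q))"
  shows "s \<otimes> b j \<in> mspan R A (set_power R (range a) Q <#> range (conv R a b))"
  using assms(4-)
proof (induction Q arbitrary: b s j)
  case 0
  have "s \<in> carrier R"
    using 0(3) by (rule mspan_closed[OF A set_power_carrier, rotated]) (use a in auto)
  then show ?case using 0(2)[of j] by (simp add: mspan.zero)
next
  case (Suc Q)
  define P where "P k = set_power R (range a) k" for k
  define h where "h = conv R a b"
  define b' where "b' = (\<lambda>j. if j < Q then b j else \<zero>)"
  define U where "U = P (Suc Q) <#> range h"
  have b: "b i \<in> carrier R" and b': "b' i \<in> carrier R" for i using Suc.prems(1) by (auto simp: b'_def)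
  have h: "h k \<in> carrier R" for k unfolding h_def using a b by (rule conv_closed)
  have Pc: "P k \<subseteq> carrier R" for k unfolding P_def by (rule set_power_carrier) (use a in auto)
  have Uc: "U \<subseteq> carrier R" unfolding U_def by (rule set_mult_carrier[OF Pc]) (use h in auto)
  have PS: "c \<otimes> a i \<in> P (Suc k)" if "c \<in> P k" for c i k
    using that by (simp add: P_def set_multI)
  have h': "conv R a b' k = h k \<ominus> (if Q \<le> k then a (k - Q) \<otimes> b Q else \<zero>)" for k
  proof -
    have "h k = conv R a b' k \<oplus> (if Q \<le> k then a (k - Q) \<otimes> b Q else \<zero>)"
      unfolding h_def b'_def by (rule conv_truncate[OF a b]) (use Suc.prems(2) in auto)
    then show ?thesis using conv_closed[OF a b', where k = k] a b
      by (simp add: a_minus_def a_assoc r_neg)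
  qed
  have trunc: "t \<otimes> b' j \<in> mspan R A (P Q <#> range (conv R a b'))" if "t \<in> mspan R A (P (Suc Q))" for t j
    unfolding P_def by (rule Suc.IH[OF b']) (use that in \<open>auto simp: b'_def P_def\<close>)
  \<comment> \<open>The factor a_i raises c to the content power Q + 1. The correction caused by
    truncating b regroups as (c a_(k-Q)) a_i b_Q with c a_(k-Q) in that same power, which is exactly
    what \<open>hyp\<close> controls.\<close>
  have lift: "a i \<otimes> u \<in> mspan R A U"
    if hyp: "\<And>s. s \<in> mspan R A (P (Suc Q)) \<Longrightarrow> s \<otimes> a i \<otimes> b Q \<in> mspan R A U"
      and u: "u \<in> mspan R A (P Q <#> range (conv R a b'))" for i u
  proof (rule mspan_mult_left[OF A _ Uc a _ u])
    show "P Q <#> range (conv R a b') \<subseteq> carrier R"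
      by (rule set_mult_carrier[OF Pc]) (use conv_closed[OF a b'] in auto)
    fix x assume "x \<in> P Q <#> range (conv R a b')"
    then obtain c k where ck: "c \<in> P Q" "x = c \<otimes> conv R a b' k" by (auto simp: set_mult_def)
    have c: "c \<in> carrier R" using ck Pc by auto
    have t1: "(c \<otimes> a i) \<otimes> h k \<in> mspan R A U"
      unfolding U_def by (rule mspan_incl[OF A Uc[unfolded U_def]]) (use PS[OF ck(1)] in \<open>auto intro!: set_multI\<close>)
    show "a i \<otimes> x \<in> mspan R A U"
    proof (cases "Q \<le> k")
      case True
      have "(c \<otimes> a (k - Q)) \<otimes> a i \<otimes> b Q \<in> mspan R A U"
        by (intro hyp mspan_incl[OF A Pc] PS ck)
      with t1 have "(c \<otimes> a i) \<otimes> h k \<ominus> (c \<otimes> a (k - Q)) \<otimes> a i \<otimes> b Q \<in> mspan R A U"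
        by (rule mspan_minus[OF A Uc])
      moreover have "a i \<otimes> x = (c \<otimes> a i) \<otimes> h k \<ominus> (c \<otimes> a (k - Q)) \<otimes> a i \<otimes> b Q"
        unfolding ck(2) h' using True c a b h
        by (simp add: a_minus_def r_distr r_minus m_ac)
      ultimately show ?thesis by simp
    next
      case False
      then have "a i \<otimes> x = (c \<otimes> a i) \<otimes> h k"
        unfolding ck(2) h' using c a h by (simp add: a_minus_def m_ac)
      then show ?thesis using t1 by simp
    qed
  qed
  have top: "s \<otimes> a i \<otimes> b Q \<in> mspan R A U" if "s \<in> mspan R A (P (Suc Q))" for i s
    using that
  proof (induction "p - i" arbitrary: i s rule: less_induct)
    case less
    have s: "s \<in> carrier R" using less.prems by (rule mspan_closed[OF A Pc])
    show ?case
    proof (cases "i < p")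
      case False
      then show ?thesis using s ap[of i] b by (simp add: mspan.zero)
    next
      case True
      \<comment> \<open>\<open>X\<close> collects the terms of h_(i+Q) with i' > i, where b enters
        with index below Q. The terms with i' < i vanish since the index of b exceeds Q, and i' = i
        gives a_i b_Q.\<close>
      define X where "X i' = (if i < i' then a i' \<otimes> b' (i + Q - i') else \<zero>)" for i'
      have X: "X i' \<in> carrier R" for i' using a b' by (auto simp: X_def)
      have "h (i + Q) = (\<Oplus>i'\<in>{..i + Q}. (if i = i' then a i' \<otimes> b Q else \<zero>) \<oplus> X i')"
        unfolding h_def conv_def
      proof (rule finsum_cong')
        fix i' assume "i' \<in> {..i + Q}"
        consider "i' < i" | "i' = i" | "i < i'" by linarith
        then show "a i' \<otimes> b (i + Q - i') = (if i = i' then a i' \<otimes> b Q else \<zero>) \<oplus> X i'"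
          using \<open>i' \<in> {..i + Q}\<close> a b Suc.prems(2)[of "i + Q - i'"] by cases (auto simp: X_def b'_def)
      qed (use a b X in auto)
      also have "\<dots> = (\<Oplus>i'\<in>{..i + Q}. if i = i' then a i' \<otimes> b Q else \<zero>) \<oplus> (\<Oplus>i'\<in>{..i + Q}. X i')"
        by (rule finsum_addf) (use a b X in auto)
      also have "(\<Oplus>i'\<in>{..i + Q}. if i = i' then a i' \<otimes> b Q else \<zero>) = a i \<otimes> b Q"
        using add.finprod_singleton[of i "{..i + Q}" "\<lambda>i. a i \<otimes> b Q"] a b by simp
      finally have hX: "h (i + Q) = a i \<otimes> b Q \<oplus> (\<Oplus>i'\<in>{..i + Q}. X i')" .
      define Y where "Y = (\<Oplus>i'\<in>{..i + Q}. X i')"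
      have Y: "Y \<in> carrier R" unfolding Y_def using X by (intro finsum_closed) auto
      have "s \<otimes> Y = (\<Oplus>i'\<in>{..i + Q}. s \<otimes> X i')"
        unfolding Y_def by (rule finsum_rdistr) (use s X in auto)
      also have "\<dots> \<in> mspan R A U"
      proof (rule mspan_finsum[OF A Uc])
        fix i' assume "i' \<in> {..i + Q}"
        show "s \<otimes> X i' \<in> mspan R A U"
        proof (cases "i < i'")
          case lt: True
          have "a i' \<otimes> (s \<otimes> b' (i + Q - i')) \<in> mspan R A U"
            using lift[OF less.hyps trunc[OF less.prems]] lt True by auto
          then show ?thesis using lt s a b' by (simp add: X_def m_lcomm)
        qed (use s in \<open>simp add: X_def mspan.zero\<close>)
      qed simp
      finally have sY: "s \<otimes> Y \<in> mspan R A U" .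
      have "s \<otimes> h (i + Q) \<in> mspan R A U"
      proof (rule mspan_mult[OF A Pc _ Uc _ less.prems])
        show "h (i + Q) \<in> mspan R A (range h)" "range h \<subseteq> carrier R"
          using h by (auto intro!: mspan_incl[OF A])
        show "x \<otimes> y \<in> mspan R A U" if "x \<in> P (Suc Q)" "y \<in> range h" for x y
          using that by (intro mspan_incl[OF A Uc]) (auto simp: U_def intro!: set_multI)
      qed
      then have "s \<otimes> h (i + Q) \<ominus> s \<otimes> Y \<in> mspan R A U" using sY by (rule mspan_minus[OF A Uc])
      moreover have "s \<otimes> h (i + Q) \<ominus> s \<otimes> Y = s \<otimes> a i \<otimes> b Q"
        unfolding hX Y_def[symmetric] using s a b Y
        by (simp add: r_distr a_minus_def a_assoc m_assoc r_neg)
      ultimately show ?thesis by simp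
    qed
  qed
  have "b j \<otimes> s \<in> mspan R A U"
  proof (rule mspan_mult_left[OF A Pc Uc b])
    show "s \<in> mspan R A (P (Suc (Suc Q)))" using Suc.prems(3) by (simp add: P_def)
    fix x assume "x \<in> P (Suc (Suc Q))"
    then obtain c i where ci: "c \<in> P (Suc Q)" "x = c \<otimes> a i" by (auto simp: P_def set_mult_def)
    have c: "c \<in> carrier R" "c \<in> mspan R A (P (Suc Q))" using ci Pc mspan_incl[OF A Pc] by auto
    consider "j < Q" | "j = Q" | "j > Q" by linarith
    then show "b j \<otimes> x \<in> mspan R A U"
    proof cases
      case 1
      have "a i \<otimes> (c \<otimes> b' j) \<in> mspan R A U" by (rule lift[OF top trunc[OF c(2)]])
      then show ?thesis using c a b 1 ci(2) by (simp add: b'_def m_ac)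
    next
      case 2
      then show ?thesis using top[OF c(2), of i] c a b ci(2) by (simp add: m_ac)
    next
      case 3
      then show ?thesis using Suc.prems(2)[of j] c a ci(2) by (simp add: mspan.zero)
    qed
  qed
  moreover have "s \<in> carrier R"
    using Suc.prems(3) mspan_closed[OF A Pc] by (simp only: P_def)
  ultimately show ?case using b by (simp add: m_comm U_def P_def h_def)
qed

text \<open>\<open>a\<close> lists the components of an element F, and \<open>f j\<close> those of
  F^j. The exponent \<open>E\<close> of the content power also bounds the indices of nonzero
  components of every F^j with j < n. A further factor a_i makes the exponent E + 1, and
  Dedekind--Mertens brings it back to E at the price of replacing F^j by F^(j+1); \<open>rel\<close>
  takes care of j + 1 = n.\<close>

lemma integral_over_components:
  assumes A: "subring A R" and a: "\<And>i. a i \<in> carrier R" and ap: "\<And>i. i \<ge> p \<Longrightarrow> a i = \<zero>"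
    and f: "\<And>j k. f j k \<in> carrier R" and fE: "\<And>j k. j < n \<Longrightarrow> k \<ge> E \<Longrightarrow> f j k = \<zero>"
    and f0: "f 0 0 = \<one>" and fS: "\<And>j. f (Suc j) = conv R a (f j)" and n: "n > 0"
    and rel: "\<And>k. f n k \<in> mspan R A {f j k' | j k'. j < n}"
  shows "integral_over R A (a i)"
proof -
  define P where "P = set_power R (range a) E"
  define F where "F = {f j k | j k. j < n}"
  define G where "G = P <#> F"
  have ar: "range a \<subseteq> carrier R" using a by auto
  have Pc: "P \<subseteq> carrier R" unfolding P_def by (rule set_power_carrier[OF ar])
  have Fc: "F \<subseteq> carrier R" using f by (auto simp: F_def)
  have Gc: "G \<subseteq> carrier R" unfolding G_def by (rule set_mult_carrier[OF Pc Fc])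
  have "range a \<subseteq> insert \<zero> (a ` {..<p})"
  proof safe
    fix i assume "a i \<notin> a ` {..<p}"
    then show "a i = \<zero>" using ap[of i] by (cases "i < p") auto
  qed
  then have "finite (range a)" by (rule finite_subset) simp
  moreover have "F \<subseteq> insert \<zero> ((\<lambda>(j, k). f j k) ` ({..<n} \<times> {..<E}))"
  proof
    fix x assume "x \<in> F"
    then obtain j k where "j < n" "x = f j k" by (auto simp: F_def)
    then show "x \<in> insert \<zero> ((\<lambda>(j, k). f j k) ` ({..<n} \<times> {..<E}))"
      using fE[of j k] by (cases "k < E") auto
  qed
  then have "finite F" by (rule finite_subset) simp
  ultimately have Gf: "finite G" unfolding G_def P_def
    by (simp add: finite_set_power set_mult_def)
  have stable: "a i \<otimes> g \<in> mspan R A G" if "g \<in> G" for g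
  proof -
    obtain c j k where g: "c \<in> P" "j < n" "g = c \<otimes> f j k"
      using \<open>g \<in> G\<close> by (auto simp: G_def F_def set_mult_def)
    have c: "c \<in> carrier R" using g Pc by auto
    have ca: "c \<otimes> a i \<in> set_power R (range a) (Suc E)" using g by (simp add: P_def set_multI)
    have "(c \<otimes> a i) \<otimes> f j k \<in> mspan R A (P <#> range (f (Suc j)))"
      unfolding P_def fS
      using fE[OF g(2)] mspan_incl[OF A set_power_carrier[OF ar] ca]
      by (intro dedekind_mertens[OF A a ap f])
    moreover have "mspan R A (P <#> range (f (Suc j))) \<subseteq> mspan R A G"
    proof
      fix s assume "s \<in> mspan R A (P <#> range (f (Suc j)))"
      then show "s \<in> mspan R A G"
      proof (rule mspan_least[OF A Gc, rotated], intro subsetI)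
        fix x assume "x \<in> P <#> range (f (Suc j))"
        then obtain c k where x: "c \<in> P" "x = c \<otimes> f (Suc j) k" by (auto simp: set_mult_def)
        have "f (Suc j) k \<in> mspan R A F"
        proof (cases "Suc j < n")
          case True
          then show ?thesis by (intro mspan_incl[OF A Fc]) (auto simp: F_def)
        next
          case False
          then have "Suc j = n" using g by simp
          then show ?thesis using rel by (simp add: F_def)
        qed
        then show "x \<in> mspan R A G" unfolding x(2)
        proof (rule mspan_mult_left[OF A Fc Gc, rotated -1])
          show "c \<in> carrier R" using x Pc by auto
          show "c \<otimes> y \<in> mspan R A G" if "y \<in> F" for y
            using that x by (intro mspan_incl[OF A Gc]) (auto simp: G_def intro!: set_multI)
        qed
      qed
    qed
    ultimately show ?thesis using g(3) c a f by (auto simp: m_ac)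
  qed
  \<comment> \<open>As 1 is a component of F^0, the power a_i^E lies in the stable module. The
    relation for z = a_i^E involves only powers of a_i below D + E on its right-hand side, so it is
    an equation for a_i itself.\<close>
  have "f 0 0 \<in> F" using n by (auto simp: F_def)
  then have "a i [^] E \<otimes> \<one> \<in> G" unfolding G_def P_def f0 by (intro set_multI pow_in_set_power) auto
  then have "a i [^] E \<in> mspan R A G" using a by (intro mspan_incl[OF A Gc]) auto
  then obtain D where "a i [^] (D::nat) \<otimes> a i [^] E \<in> mspan R A {a i [^] k \<otimes> a i [^] E | k. k < D}"
    using stable_module_relation[OF A a Gf Gc stable] by blast
  moreover have "{a i [^] k \<otimes> a i [^] E | k. k < D} \<subseteq> (\<lambda>k. a i [^] k) ` {..<D + E}"
    using a by (auto simp: nat_pow_mult)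
  ultimately have "a i [^] D \<otimes> a i [^] E \<in> mspan R A ((\<lambda>k. a i [^] k) ` {..<D + E})"
    using mspan_mono by blast
  then have "a i [^] (D + E) \<in> mspan R A ((\<lambda>k. a i [^] k) ` {..<D + E})"
    using nat_pow_mult[OF a] by simp
  then show ?thesis unfolding integral_over_def by blast
qed

end

section \<open>Integral closures of Rees algebras\<close>

lemma filtration_ideal: "filtration R I \<Longrightarrow> ideal (I m) R"
  by (simp add: filtration_def)

lemma filtration_carrier: "filtration R I \<Longrightarrow> f \<in> I m \<Longrightarrow> f \<in> carrier R"
  using ideal.Icarr filtration_ideal by metis

lemma filtration_0: "filtration R I \<Longrightarrow> I 0 = carrier R"
  by (simp add: filtration_def)

lemma filtration_antimono: "filtration R I \<Longrightarrow> m \<le> n \<Longrightarrow> I n \<subseteq> I m"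
  by (rule lift_Suc_antimono_le) (simp_all add: filtration_def)

lemma filtration_zero: "filtration R I \<Longrightarrow> \<zero>\<^bsub>R\<^esub> \<in> I m"
  by (simp add: additive_subgroup.zero_closed filtration_ideal ideal.axioms(1))

lemma filtration_mult: "filtration R I \<Longrightarrow> f \<in> I m \<Longrightarrow> g \<in> I n \<Longrightarrow> f \<otimes>\<^bsub>R\<^esub> g \<in> I (m + n)"
  using ideal_prod.prod[of f "I m" g "I n" R] unfolding filtration_def by blast

lemma filtration_pow:
  assumes "cring R" "filtration R I" "f \<in> I m"
  shows "f [^]\<^bsub>R\<^esub> (k::nat) \<in> I (m * k)"
proof (induction k)
  case 0
  interpret cring R by fact
  show ?case using filtration_0[OF assms(2)] by simp
next
  case (Suc k)
  interpret cring R by fact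
  show ?case using filtration_mult[OF assms(2) Suc assms(3)] by (simp add: algebra_simps)
qed

lemma (in cring) ideal_finsum_closed:
  assumes I: "ideal I R" and "finite S" "\<And>i. i \<in> S \<Longrightarrow> f i \<in> I"
  shows "finsum R f S \<in> I"
  using assms(2,3)
proof (induction S rule: finite_induct)
  case empty
  then show ?case by (simp add: additive_subgroup.zero_closed I ideal.axioms(1))
next
  case (insert i S)
  then have "finsum R f (insert i S) = f i \<oplus> finsum R f S"
    using ideal.Icarr[OF I] by (intro finsum_insert) auto
  then show ?case using insert by (simp add: additive_subgroup.a_closed I ideal.axioms(1))
qed

lemma (in cring) ideal_pow_ideal: "ideal K R \<Longrightarrow> ideal (K [^]\<^bsub>ideals_set R\<^esub> (n::nat)) R"
  using monoid.nat_pow_closed[OF comm_monoid.axioms(1)[OF ideals_set_is_comm_monoid], of K n]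
  by (simp add: ideals_set_def)

lemma (in cring) ideal_pow_prod:
  "ideal K R \<Longrightarrow> (K [^]\<^bsub>ideals_set R\<^esub> (m::nat)) \<cdot> (K [^]\<^bsub>ideals_set R\<^esub> n) = K [^]\<^bsub>ideals_set R\<^esub> (m + n)"
  using monoid.nat_pow_mult[OF comm_monoid.axioms(1)[OF ideals_set_is_comm_monoid], of K m n]
  by (simp add: ideals_set_def)

lemma (in cring) ideal_pow_antimono:
  assumes K: "ideal K R" and "m \<le> n"
  shows "K [^]\<^bsub>ideals_set R\<^esub> (n::nat) \<subseteq> K [^]\<^bsub>ideals_set R\<^esub> m"
proof -
  have "(K [^]\<^bsub>ideals_set R\<^esub> m) \<cdot> (K [^]\<^bsub>ideals_set R\<^esub> (n - m)) \<subseteq> K [^]\<^bsub>ideals_set R\<^esub> m"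
    using ideal_prod_inter[OF ideal_pow_ideal[OF K] ideal_pow_ideal[OF K]] by blast
  then show ?thesis using assms by (simp add: ideal_pow_prod)
qed

lemma (in cring) ideal_pow_1: "ideal K R \<Longrightarrow> K [^]\<^bsub>ideals_set R\<^esub> (1::nat) = K"
  using monoid.nat_pow_eone[OF comm_monoid.axioms(1)[OF ideals_set_is_comm_monoid], of K]
  by (simp add: ideals_set_def)

lemma (in cring) ideal_pow_subset_filtration:
  assumes I: "filtration R I"
  shows "I m [^]\<^bsub>ideals_set R\<^esub> (k::nat) \<subseteq> I (m * k)"
proof (induction k)
  case 0
  then show ?case using filtration_0[OF I] by (simp add: ideals_set_def)
next
  case (Suc k)
  have "I m [^]\<^bsub>ideals_set R\<^esub> Suc k = (I m [^]\<^bsub>ideals_set R\<^esub> k) \<cdot> I m"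
    by (simp add: ideals_set_def)
  also have "\<dots> \<subseteq> I (m * k) \<cdot> I m"
  proof
    fix s assume "s \<in> (I m [^]\<^bsub>ideals_set R\<^esub> k) \<cdot> I m"
    then show "s \<in> I (m * k) \<cdot> I m"
      by (induction rule: ideal_prod.induct) (use Suc in \<open>auto intro: ideal_prod.intros\<close>)
  qed
  also have "\<dots> \<subseteq> I (m * Suc k)" using I by (simp add: filtration_def add.commute)
  finally show ?case .
qed

text \<open>The exponent is the ceiling of k/r, and ceilings are subadditive. The filtration
  stretches the powers of K to steps of length r.\<close>

lemma (in cring) filtration_ideal_pow_div:
  assumes K: "ideal K R" and r: "r > 0"
  shows "filtration R (\<lambda>k. K [^]\<^bsub>ideals_set R\<^esub> ((k + r - 1) div r))"
  unfolding filtration_def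
proof (intro conjI allI)
  show "K [^]\<^bsub>ideals_set R\<^esub> ((0 + r - 1) div r) = carrier R"
    using r by (simp add: ideals_set_def)
  show "K [^]\<^bsub>ideals_set R\<^esub> ((Suc n + r - 1) div r) \<subseteq> K [^]\<^bsub>ideals_set R\<^esub> ((n + r - 1) div r)" for n
    by (intro ideal_pow_antimono[OF K] div_le_mono) simp
  show "(K [^]\<^bsub>ideals_set R\<^esub> ((n + r - 1) div r)) \<cdot> (K [^]\<^bsub>ideals_set R\<^esub> ((m + r - 1) div r))
      \<subseteq> K [^]\<^bsub>ideals_set R\<^esub> ((n + m + r - 1) div r)" for m n
    unfolding ideal_pow_prod[OF K]
  proof (rule ideal_pow_antimono[OF K])
    have *: "k \<le> r * ((k + r - 1) div r)" for k
    proof -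
      have "k + r - 1 = r * ((k + r - 1) div r) + (k + r - 1) mod r" by simp
      moreover have "(k + r - 1) mod r < r" using r by simp
      ultimately show ?thesis using r by linarith
    qed
    have "(n + m + r - 1) div r \<le> (r * ((n + r - 1) div r + (m + r - 1) div r) + (r - 1)) div r"
      using *[of n] *[of m] r by (intro div_le_mono) (simp add: distrib_left)
    also have "\<dots> = (n + r - 1) div r + (m + r - 1) div r"
      by (rule div_nat_eqI) (use r in auto)
    finally show "(n + m + r - 1) div r \<le> (n + r - 1) div r + (m + r - 1) div r" .
  qed
qed (rule ideal_pow_ideal[OF K])

lemma (in cring) filt_integral_closure_carrier: "filt_integral_closure R I m \<subseteq> carrier R"
  by (auto simp: filt_integral_closure_def)

section \<open>Rees algebras as graded subrings of the polynomial ring\<close>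

context UP_cring
begin

lemma monom_finsum:
  assumes "finite S" "\<And>i. i \<in> S \<Longrightarrow> g i \<in> carrier R"
  shows "monom P (finsum R g S) n = finsum P (\<lambda>i. monom P (g i) n) S"
  using assms
proof (induction S rule: finite_induct)
  case (insert i S)
  have "finsum R g (insert i S) = g i \<oplus> finsum R g S"
    using insert by (intro R.finsum_insert) auto
  moreover have "finsum P (\<lambda>i. monom P (g i) n) (insert i S) =
      monom P (g i) n \<oplus>\<^bsub>P\<^esub> finsum P (\<lambda>i. monom P (g i) n) S"
    using insert by (intro P.finsum_insert) auto
  moreover have "finsum R g S \<in> carrier R" using insert by (intro R.finsum_closed) auto
  ultimately show ?case using insert by simp
qed simp

lemma rees_algebra_iff:
  assumes I: "filtration R I"
  shows "p \<in> rees_algebra R I \<longleftrightarrow> p \<in> carrier P \<and> (\<forall>k. coeff P p k \<in> I k)"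
proof
  assume "p \<in> rees_algebra R I"
  then obtain n a where p: "p = (\<Oplus>\<^bsub>P\<^esub>m\<in>{..n}. monom P (a m) m)" and a: "\<forall>m. a m \<in> I m"
    unfolding rees_algebra_def P_def by blast
  have ac: "a m \<in> carrier R" for m using a filtration_carrier[OF I] by blast
  have "coeff P p k \<in> I k" for k
  proof -
    have "coeff P p k = (\<Oplus>m\<in>{..n}. coeff P (monom P (a m) m) k)"
      unfolding p by (rule coeff_finsum) (use ac in auto)
    also have "\<dots> \<in> I k"
      by (rule R.ideal_finsum_closed[OF filtration_ideal[OF I]])
        (use ac a filtration_zero[OF I] in auto)
    finally show ?thesis .
  qed
  moreover have "p \<in> carrier P" unfolding p by (rule P.finsum_closed) (use ac in auto)
  ultimately show "p \<in> carrier P \<and> (\<forall>k. coeff P p k \<in> I k)" by blast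
next
  assume p: "p \<in> carrier P \<and> (\<forall>k. coeff P p k \<in> I k)"
  then have "p = (\<Oplus>\<^bsub>P\<^esub>i\<in>{..deg R p}. monom P (coeff P p i) i)" using up_repr by simp
  then show "p \<in> rees_algebra R I" using p unfolding rees_algebra_def P_def by blast
qed

lemma rees_algebra_subring:
  assumes I: "filtration R I"
  shows "subring (rees_algebra R I) P"
proof (rule P.subringI)
  note iff = rees_algebra_iff[OF I]
  have id: "ideal (I k) R" for k by (rule filtration_ideal[OF I])
  show "rees_algebra R I \<subseteq> carrier P" using iff by blast
  show "\<one>\<^bsub>P\<^esub> \<in> rees_algebra R I"
    using filtration_zero[OF I] filtration_0[OF I] by (auto simp: iff)
  show "\<ominus>\<^bsub>P\<^esub> h \<in> rees_algebra R I" if "h \<in> rees_algebra R I" for h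
    using that id by (auto simp: iff additive_subgroup.a_inv_closed ideal.axioms(1))
  show "h \<oplus>\<^bsub>P\<^esub> k \<in> rees_algebra R I" if "h \<in> rees_algebra R I" "k \<in> rees_algebra R I" for h k
    using that id by (auto simp: iff additive_subgroup.a_closed ideal.axioms(1))
  show "h \<otimes>\<^bsub>P\<^esub> k \<in> rees_algebra R I" if hk: "h \<in> rees_algebra R I" "k \<in> rees_algebra R I" for h k
  proof -
    have "(\<Oplus>i\<in>{..n}. coeff P h i \<otimes> coeff P k (n - i)) \<in> I n" for n
    proof (rule R.ideal_finsum_closed[OF id])
      fix i assume "i \<in> {..n}"
      then show "coeff P h i \<otimes> coeff P k (n - i) \<in> I n"
        using filtration_mult[OF I, of "coeff P h i" i "coeff P k (n - i)" "n - i"] hk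
        by (simp add: iff)
    qed simp
    then show ?thesis using hk by (simp add: iff)
  qed
qed

lemma monom_in_rees_algebra:
  assumes I: "filtration R I" and "c \<in> I m"
  shows "monom P c m \<in> rees_algebra R I"
  using assms filtration_carrier[OF I] filtration_zero[OF I] by (auto simp: rees_algebra_iff)

text \<open>Compare coefficients of degree mN in the monic equation: the term with c^i picks out of
  its coefficient the component of degree m(N - i).\<close>

lemma integral_over_monom_relation:
  assumes I: "filtration R I" and c: "c \<in> carrier R"
    and int: "integral_over P (rees_algebra R I) (monom P c m)"
  obtains N a where "N > 0" "\<forall>i<N. a i \<in> I (m * (N - i))"
    "c [^] (N::nat) \<oplus> (\<Oplus>i\<in>{..<N}. a i \<otimes> c [^] i) = \<zero>"
proof -
  let ?x = "monom P c m"
  have x: "?x \<in> carrier P" using c by simp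
  have xpow: "?x [^]\<^bsub>P\<^esub> i = monom P (c [^] i) (m * i)" for i :: nat
    using monom_pow[OF c] .
  have "?x \<in> integral_closure_in P (rees_algebra R I)"
    by (rule P.integral_closure_in_iff[OF rees_algebra_subring[OF I], THEN iffD2]) (simp add: int x)
  then obtain N and b :: "nat \<Rightarrow> nat \<Rightarrow> 'a" where N: "N > 0" and b: "\<And>i. i < N \<Longrightarrow> b i \<in> rees_algebra R I"
    and eq: "?x [^]\<^bsub>P\<^esub> N \<oplus>\<^bsub>P\<^esub> (\<Oplus>\<^bsub>P\<^esub>i\<in>{..<N}. b i \<otimes>\<^bsub>P\<^esub> ?x [^]\<^bsub>P\<^esub> i) = \<zero>\<^bsub>P\<^esub>"
    unfolding integral_closure_in_def by blast
  have bc: "b i \<in> carrier P" "coeff P (b i) k \<in> I k" if "i < N" for i k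
    using b[OF that] by (auto simp: rees_algebra_iff[OF I])
  have coeff: "coeff P (b i \<otimes>\<^bsub>P\<^esub> ?x [^]\<^bsub>P\<^esub> i) (m * N) = coeff P (b i) (m * (N - i)) \<otimes> c [^] i"
    if "i < N" for i
  proof -
    have "coeff P (monom P (c [^] i) (m * i) \<otimes>\<^bsub>P\<^esub> b i) (m * (N - i) + m * i) =
        c [^] i \<otimes> coeff P (b i) (m * (N - i))"
      using c bc[OF that] by (intro coeff_monom_mult) auto
    moreover have "m * (N - i) + m * i = m * N" using that by (simp flip: distrib_left)
    ultimately show ?thesis using c bc[OF that] by (simp add: xpow P.m_comm R.m_comm)
  qed
  have "coeff P (?x [^]\<^bsub>P\<^esub> N \<oplus>\<^bsub>P\<^esub> (\<Oplus>\<^bsub>P\<^esub>i\<in>{..<N}. b i \<otimes>\<^bsub>P\<^esub> ?x [^]\<^bsub>P\<^esub> i)) (m * N) =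
    coeff P (?x [^]\<^bsub>P\<^esub> N) (m * N) \<oplus> coeff P (\<Oplus>\<^bsub>P\<^esub>i\<in>{..<N}. b i \<otimes>\<^bsub>P\<^esub> ?x [^]\<^bsub>P\<^esub> i) (m * N)"
    using x bc by (intro coeff_add P.finsum_closed) auto
  also have "coeff P (\<Oplus>\<^bsub>P\<^esub>i\<in>{..<N}. b i \<otimes>\<^bsub>P\<^esub> ?x [^]\<^bsub>P\<^esub> i) (m * N) =
     (\<Oplus>i\<in>{..<N}. coeff P (b i \<otimes>\<^bsub>P\<^esub> ?x [^]\<^bsub>P\<^esub> i) (m * N))"
    using x bc by (intro coeff_finsum) auto
  also have "\<dots> = (\<Oplus>i\<in>{..<N}. coeff P (b i) (m * (N - i)) \<otimes> c [^] i)"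
    by (rule R.finsum_cong') (use coeff bc c in auto)
  also have "coeff P (?x [^]\<^bsub>P\<^esub> N) (m * N) = c [^] N" using c by (simp add: xpow)
  finally have "c [^] N \<oplus> (\<Oplus>i\<in>{..<N}. coeff P (b i) (m * (N - i)) \<otimes> c [^] i) = \<zero>"
    unfolding eq by simp
  then show thesis
    using that[of N "\<lambda>i. coeff P (b i) (m * (N - i))"] N bc(2) by blast
qed

text \<open>The equation for f^r has its i-th coefficient in the i-th power of I_(rm), which lies in
  I_(rmi). Multiplied by t^(rmn) it becomes homogeneous, a monic equation of degree rn for f
  t^m.\<close>

lemma integral_over_monom_if:
  assumes I: "filtration R I" and f: "f \<in> filt_integral_closure R I m"
  shows "integral_over P (rees_algebra R I) (monom P f m)"
proof -
  note A = rees_algebra_subring[OF I]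
  obtain r n a where fc: "f \<in> carrier R" and r: "r > 0" and n: "n > (0::nat)"
    and a: "\<And>i. i \<in> {1..n} \<Longrightarrow> a i \<in> I (r * m) [^]\<^bsub>ideals_set R\<^esub> i"
    and eq: "(f [^] r) [^] n \<oplus> (\<Oplus>i\<in>{1..n}. a i \<otimes> (f [^] r) [^] (n - i)) = \<zero>"
    using f unfolding filt_integral_closure_def ideal_integral_closure_def by blast
  let ?x = "monom P f m"
  have x: "?x \<in> carrier P" using fc by simp
  have ai: "a i \<in> I (r * m * i)" if "i \<in> {1..n}" for i
    using a[OF that] R.ideal_pow_subset_filtration[OF I] by blast
  have ac: "a i \<in> carrier R" if "i \<in> {1..n}" for i
    using ai[OF that] filtration_carrier[OF I] by blast
  define S where "S = (\<Oplus>i\<in>{1..n}. a i \<otimes> (f [^] r) [^] (n - i))"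
  have Sc: "S \<in> carrier R" unfolding S_def using ac fc by (intro R.finsum_closed) auto
  have "(f [^] r) [^] n = \<ominus> S" using eq Sc fc unfolding S_def[symmetric]
    by (intro R.sum_zero_eq_neg) auto
  then have fS: "f [^] (r * n) = \<ominus> S" using fc by (simp add: R.nat_pow_pow)
  let ?X = "(\<lambda>i. ?x [^]\<^bsub>P\<^esub> i) ` {..<r * n}"
  have Xc: "?X \<subseteq> carrier P" using x by auto
  have "monom P S (m * (r * n)) =
      (\<Oplus>\<^bsub>P\<^esub>i\<in>{1..n}. monom P (a i \<otimes> (f [^] r) [^] (n - i)) (m * (r * n)))"
    unfolding S_def by (rule monom_finsum) (use ac fc in auto)
  also have "\<dots> \<in> mspan P (rees_algebra R I) ?X"
  proof (rule P.mspan_finsum[OF A Xc])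
    fix i assume i: "i \<in> {1..n}"
    have e: "m * (r * n) = r * m * i + m * (r * (n - i))"
    proof -
      have "n = i + (n - i)" using i by simp
      then have "m * (r * n) = m * (r * (i + (n - i)))" by simp
      then show ?thesis by (simp only: distrib_left mult_ac)
    qed
    have "monom P (a i \<otimes> (f [^] r) [^] (n - i)) (m * (r * n)) =
        monom P (a i) (r * m * i) \<otimes>\<^bsub>P\<^esub> monom P (f [^] (r * (n - i))) (m * (r * (n - i)))"
      unfolding e using ac[OF i] fc by (simp add: R.nat_pow_pow)
    also have "\<dots> = monom P (a i) (r * m * i) \<otimes>\<^bsub>P\<^esub> ?x [^]\<^bsub>P\<^esub> (r * (n - i))"
      using monom_pow[OF fc] by simp
    also have "\<dots> \<in> mspan P (rees_algebra R I) ?X"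
    proof (intro P.mspan_smult[OF A Xc] P.mspan_incl[OF A Xc] imageI)
      show "monom P (a i) (r * m * i) \<in> rees_algebra R I"
        by (rule monom_in_rees_algebra[OF I ai[OF i]])
      show "r * (n - i) \<in> {..<r * n}" using i r by simp
    qed
    finally show "monom P (a i \<otimes> (f [^] r) [^] (n - i)) (m * (r * n)) \<in>
      mspan P (rees_algebra R I) ?X" .
  qed simp
  finally have "\<ominus>\<^bsub>P\<^esub> (monom P S (m * (r * n))) \<in> mspan P (rees_algebra R I) ?X"
    by (rule P.mspan_uminus[OF A Xc])
  then have "?x [^]\<^bsub>P\<^esub> (r * n) \<in> mspan P (rees_algebra R I) ?X"
    using monom_pow[OF fc] fS Sc by simp
  then show ?thesis unfolding integral_over_def by blast
qed

text \<open>The coefficients \<open>a\<^sub>i \<in> I\<^bsub>m(N-i)\<^esub>\<close> need not lie in powers of a single ideal. With \<open>r = N!\<close> and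
  \<open>K = I\<^bsub>rm\<^esub>\<close>, however, a power of \<open>a\<^sub>i t\<^bsup>N-i\<^esup>\<close> lies in \<open>K t\<^sup>r\<close>. Hence \<open>f t\<close> is integral over the Rees
  algebra of the filtration \<open>Q\<^sub>k = K\<^bsup>\<lceil>k/r\<rceil>\<^esup>\<close>, and so is \<open>(f t)\<^sup>r\<close>, whose degree is the spacing of \<open>Q\<close>.\<close>

lemma integral_over_monom_only_if:
  assumes I: "filtration R I" and f: "f \<in> carrier R"
    and int: "integral_over P (rees_algebra R I) (monom P f m)"
  shows "f \<in> filt_integral_closure R I m"
proof -
  obtain N a where N: "N > 0" and "\<forall>i<N. a i \<in> I (m * (N - i))"
    and eq: "f [^] (N::nat) \<oplus> (\<Oplus>i\<in>{..<N}. a i \<otimes> f [^] i) = \<zero>"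
    by (rule integral_over_monom_relation[OF I f int])
  then have a: "a i \<in> I (m * (N - i))" if "i < N" for i using that by blast
  have ac: "a i \<in> carrier R" if "i < N" for i using a[OF that] filtration_carrier[OF I] by blast
  define r :: nat where "r = fact N"
  have r: "r > 0" by (simp add: r_def)
  define K where "K = I (r * m)"
  have K: "ideal K R" unfolding K_def by (rule filtration_ideal[OF I])
  define Q where "Q k = K [^]\<^bsub>ideals_set R\<^esub> ((k + r - 1) div r)" for k
  have Q: "filtration R Q" unfolding Q_def by (rule R.filtration_ideal_pow_div[OF K r])
  \<comment> \<open>At multiples of r the ceiling is exact. This is what finally puts the
    coefficients into powers of the single ideal K.\<close>
  have Qr: "Q (r * k) = K [^]\<^bsub>ideals_set R\<^esub> k" for k
  proof -
    have "(r * k + r - 1) div r = ((r - 1) + r * k) div r" using r by (simp add: algebra_simps)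
    also have "\<dots> = k" by (rule div_nat_eqI) (use r in auto)
    finally show ?thesis by (simp add: Q_def)
  qed
  note A = rees_algebra_subring[OF Q]
  \<comment> \<open>One power of t stands for m steps of the filtration: t^(N-i) accompanies a
    coefficient from I_(m(N-i)). This also covers m = 0.\<close>
  let ?x = "monom P f 1"
  define z where "z i = monom P (\<ominus> a i) (N - i)" for i
  have x: "?x \<in> carrier P" using f by simp
  have zc: "z i \<in> carrier P" if "i < N" for i using ac[OF that] by (simp add: z_def)
  have zint: "integral_over P (rees_algebra R Q) (z i)" if "i < N" for i
  proof -
    have "(N - i) dvd r" unfolding r_def using that by (intro dvd_fact) auto
    then obtain e where e: "r = (N - i) * e" by blast
    with r have e0: "e > 0" by (cases e) auto
    have "\<ominus> a i \<in> I (m * (N - i))" using a[OF that] filtration_ideal[OF I]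
      by (simp add: additive_subgroup.a_inv_closed ideal.axioms(1))
    then have "(\<ominus> a i) [^] e \<in> I (m * (N - i) * e)" by (rule filtration_pow[OF R.is_cring I])
    also have "m * (N - i) * e = r * m" using e by simp
    finally have "(\<ominus> a i) [^] e \<in> Q (r * 1)"
      unfolding Qr using R.ideal_pow_1[OF K] by (simp add: K_def)
    then have "monom P ((\<ominus> a i) [^] e) r \<in> rees_algebra R Q" using monom_in_rees_algebra[OF Q] by simp
    then have "z i [^]\<^bsub>P\<^esub> e \<in> rees_algebra R Q"
      unfolding z_def using monom_pow[of "\<ominus> a i" "N - i" e] ac[OF that] e by simp
    then show ?thesis by (rule P.integral_over_root[OF A zc[OF that] e0])
  qed
  have "integral_over P (rees_algebra R Q) (?x [^]\<^bsub>P\<^esub> r)"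
  proof (rule P.integral_over_pow_trans[OF A])
    let ?X = "(\<lambda>i. ?x [^]\<^bsub>P\<^esub> i) ` {..<N}"
    show "finite (z ` {..<N})" by simp
    show "z ` {..<N} \<subseteq> carrier P" using zc by auto
    show "?x \<in> carrier P" by fact
    show "integral_over P (rees_algebra R Q) y" if y: "y \<in> z ` {..<N}" for y
      using y zint by auto
    have "f [^] N = \<ominus> (\<Oplus>i\<in>{..<N}. a i \<otimes> f [^] i)"
      by (rule R.sum_zero_eq_neg[OF _ _ eq]) (use f ac in \<open>auto intro!: R.finsum_closed\<close>)
    also have "\<dots> = (\<ominus> \<one>) \<otimes> (\<Oplus>i\<in>{..<N}. a i \<otimes> f [^] i)"
    proof -
      have "(\<Oplus>i\<in>{..<N}. a i \<otimes> f [^] i) \<in> carrier R"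
        using f ac by (intro R.finsum_closed) auto
      then show ?thesis by (simp add: R.l_minus)
    qed
    also have "\<dots> = (\<Oplus>i\<in>{..<N}. (\<ominus> \<one>) \<otimes> (a i \<otimes> f [^] i))"
      by (rule R.finsum_rdistr) (use f ac in auto)
    also have "\<dots> = (\<Oplus>i\<in>{..<N}. (\<ominus> a i) \<otimes> f [^] i)"
      by (rule R.finsum_cong') (use f ac in \<open>auto simp: R.l_minus\<close>)
    finally have "?x [^]\<^bsub>P\<^esub> N = monom P (\<Oplus>i\<in>{..<N}. (\<ominus> a i) \<otimes> f [^] i) N"
      using monom_pow[OF f] by simp
    also have "\<dots> = (\<Oplus>\<^bsub>P\<^esub>i\<in>{..<N}. monom P ((\<ominus> a i) \<otimes> f [^] i) N)"
      by (rule monom_finsum) (use ac f in auto)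
    also have "\<dots> = (\<Oplus>\<^bsub>P\<^esub>i\<in>{..<N}. z i \<otimes>\<^bsub>P\<^esub> ?x [^]\<^bsub>P\<^esub> i)"
    proof (rule P.finsum_cong')
      fix i assume "i \<in> {..<N}"
      then have i: "i < N" "N - i + i = N" by auto
      have "monom P (\<ominus> a i \<otimes> f [^] i) (N - i + i) = monom P (\<ominus> a i) (N - i) \<otimes>\<^bsub>P\<^esub> monom P (f [^] i) i"
        using ac[OF i(1)] f by (intro monom_mult) auto
      then show "monom P (\<ominus> a i \<otimes> f [^] i) N = z i \<otimes>\<^bsub>P\<^esub> ?x [^]\<^bsub>P\<^esub> i"
        using ac[OF i(1)] i(2) monom_pow[OF f, of 1 i] by (simp add: z_def)
    qed (use zc x in auto)
    finally have xN: "?x [^]\<^bsub>P\<^esub> N = (\<Oplus>\<^bsub>P\<^esub>i\<in>{..<N}. z i \<otimes>\<^bsub>P\<^esub> ?x [^]\<^bsub>P\<^esub> i)" .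
    \<comment> \<open>The coefficients form a finite set and not a subring, so the sum is assembled
      term by term from the introduction rules of \<open>mspan\<close>.\<close>
    have part: "(\<Oplus>\<^bsub>P\<^esub>i\<in>{..<k}. z i \<otimes>\<^bsub>P\<^esub> ?x [^]\<^bsub>P\<^esub> i) \<in> mspan P (z ` {..<N}) ?X"
      if "k \<le> N" for k
      using that
    proof (induction k)
      case 0
      then show ?case by (simp add: mspan.zero)
    next
      case (Suc k)
      have "(\<Oplus>\<^bsub>P\<^esub>i\<in>{..<Suc k}. z i \<otimes>\<^bsub>P\<^esub> ?x [^]\<^bsub>P\<^esub> i) = z k \<otimes>\<^bsub>P\<^esub> ?x [^]\<^bsub>P\<^esub> k \<oplus>\<^bsub>P\<^esub>
          (\<Oplus>\<^bsub>P\<^esub>i\<in>{..<k}. z i \<otimes>\<^bsub>P\<^esub> ?x [^]\<^bsub>P\<^esub> i)"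
        unfolding lessThan_Suc using Suc.prems zc x by (intro P.finsum_insert) auto
      then show ?case using Suc by (auto intro!: mspan.step)
    qed
    show "?x [^]\<^bsub>P\<^esub> N \<in> mspan P (z ` {..<N}) ?X"
      unfolding xN by (rule part) simp
  qed
  then have "integral_over P (rees_algebra R Q) (monom P (f [^] r) r)"
    using monom_pow[OF f] by simp
  then obtain M c where M: "M > 0" and c: "\<And>i. i < M \<Longrightarrow> c i \<in> Q (r * (M - i))"
    and ceq: "(f [^] r) [^] (M::nat) \<oplus> (\<Oplus>i\<in>{..<M}. c i \<otimes> (f [^] r) [^] i) = \<zero>"
    using integral_over_monom_relation[OF Q, of "f [^] r" r] f by auto
  have cc: "c i \<in> carrier R" if "i < M" for i using c[OF that] filtration_carrier[OF Q] by blast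
  \<comment> \<open>Over a ring the coefficients are indexed by the power of the element, over an
    ideal by the complementary exponent; hence the reindexing by M - j.\<close>
  have "(\<Oplus>i\<in>{..<M}. c i \<otimes> (f [^] r) [^] i) =
      (\<Oplus>i\<in>(\<lambda>j. M - j) ` {1..M}. c i \<otimes> (f [^] r) [^] i)"
  proof (rule arg_cong[of _ _ "finsum R _"])
    show "{..<M} = (\<lambda>j. M - j) ` {1..M}"
    proof (intro equalityI subsetI)
      fix i assume "i \<in> {..<M}"
      then have "i = M - (M - i)" "M - i \<in> {1..M}" by auto
      then show "i \<in> (\<lambda>j. M - j) ` {1..M}" by blast
    qed auto
  qed
  also have "\<dots> = (\<Oplus>j\<in>{1..M}. c (M - j) \<otimes> (f [^] r) [^] (M - j))"
    by (rule R.finsum_reindex) (use cc f in \<open>auto simp: inj_on_def\<close>)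
  finally have "(f [^] r) [^] M \<oplus> (\<Oplus>j\<in>{1..M}. c (M - j) \<otimes> (f [^] r) [^] (M - j)) = \<zero>"
    using ceq by simp
  moreover have "c (M - j) \<in> K [^]\<^bsub>ideals_set R\<^esub> j" if "j \<in> {1..M}" for j
    using c[of "M - j"] that Qr by simp
  ultimately have "f [^] r \<in> ideal_integral_closure R K"
    unfolding ideal_integral_closure_def using f M
    by (intro CollectI conjI exI[of _ M] exI[of _ "\<lambda>j. c (M - j)"]) auto
  then show ?thesis unfolding filt_integral_closure_def K_def using f r by blast
qed

text \<open>Since the Rees algebra is graded, the relation for p^n splits by degrees: the degree k
  part of c p^j combines components of p^j with coefficients c_i t^i that lie in the algebra again.
  This supplies \<open>rel\<close> in \<open>integral_over_components\<close>, which is applied in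
  the polynomial ring itself.\<close>

lemma integral_over_homogeneous_component:
  assumes I: "filtration R I" and p: "p \<in> carrier P"
    and int: "integral_over P (rees_algebra R I) p"
  shows "integral_over P (rees_algebra R I) (monom P (coeff P p k) k)"
proof -
  note A = rees_algebra_subring[OF I]
  obtain n and b :: "nat \<Rightarrow> nat \<Rightarrow> 'a" where n: "n > 0" and b: "\<forall>i<n. b i \<in> rees_algebra R I"
    and eq: "p [^]\<^bsub>P\<^esub> n \<oplus>\<^bsub>P\<^esub> (\<Oplus>\<^bsub>P\<^esub>i\<in>{..<n}. b i \<otimes>\<^bsub>P\<^esub> p [^]\<^bsub>P\<^esub> i) = \<zero>\<^bsub>P\<^esub>"
    using P.integral_closure_in_iff[OF A, of p] int p unfolding integral_closure_in_def by blast
  let ?X = "(\<lambda>i. p [^]\<^bsub>P\<^esub> i) ` {..<n}"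
  have Xc: "?X \<subseteq> carrier P" using p by auto
  define S where "S = (\<Oplus>\<^bsub>P\<^esub>i\<in>{..<n}. b i \<otimes>\<^bsub>P\<^esub> p [^]\<^bsub>P\<^esub> i)"
  have S: "S \<in> mspan P (rees_algebra R I) ?X"
    unfolding S_def by (rule P.mspan_explicit[OF A, THEN iffD2]) (use b p in auto)
  then have "p [^]\<^bsub>P\<^esub> n = \<ominus>\<^bsub>P\<^esub> S"
    using eq p P.mspan_closed[OF A Xc] unfolding S_def[symmetric]
    by (intro P.sum_zero_eq_neg) auto
  with S have pn: "p [^]\<^bsub>P\<^esub> n \<in> mspan P (rees_algebra R I) ?X"
    using P.mspan_uminus[OF A Xc] by simp
  define f where "f j k = monom P (coeff P (p [^]\<^bsub>P\<^esub> j) k) k" for j k :: nat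
  define F where "F = {f j k |j k. j < n}"
  \<comment> \<open>Exceeds the degrees of all p^j with j < n, since one bound must serve all of
    them.\<close>
  define E where "E = Suc (Max ((\<lambda>j. deg R (p [^]\<^bsub>P\<^esub> j)) ` {..<n}))"
  have pc: "p [^]\<^bsub>P\<^esub> j \<in> carrier P" for j :: nat using p by simp
  have fc: "f j k \<in> carrier P" for j k using pc by (simp add: f_def)
  have Fc: "F \<subseteq> carrier P" using fc by (auto simp: F_def)
  have monom_coeff_mult: "monom P (coeff P (q \<otimes>\<^bsub>P\<^esub> s) k) k =
      (\<Oplus>\<^bsub>P\<^esub>i\<in>{..k}. monom P (coeff P q i) i \<otimes>\<^bsub>P\<^esub> monom P (coeff P s (k - i)) (k - i))"
    if "q \<in> carrier P" "s \<in> carrier P" for q s k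
  proof -
    have "monom P (coeff P (q \<otimes>\<^bsub>P\<^esub> s) k) k =
        (\<Oplus>\<^bsub>P\<^esub>i\<in>{..k}. monom P (coeff P q i \<otimes> coeff P s (k - i)) k)"
      using that by (simp add: monom_finsum)
    also have "\<dots> = (\<Oplus>\<^bsub>P\<^esub>i\<in>{..k}. monom P (coeff P q i) i \<otimes>\<^bsub>P\<^esub> monom P (coeff P s (k - i)) (k - i))"
    proof (rule P.finsum_cong')
      fix i assume "i \<in> {..k}"
      then have "i + (k - i) = k" by simp
      then show "monom P (coeff P q i \<otimes> coeff P s (k - i)) k =
          monom P (coeff P q i) i \<otimes>\<^bsub>P\<^esub> monom P (coeff P s (k - i)) (k - i)"
        using monom_mult[of "coeff P q i" "coeff P s (k - i)" i "k - i"] that by simp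
    qed (use that in auto)
    finally show ?thesis .
  qed
  have comp: "monom P (coeff P s k) k \<in> mspan P (rees_algebra R I) F"
    if "s \<in> mspan P (rees_algebra R I) ?X" for s k
    using that
  proof (induction rule: mspan.induct)
    case zero
    then show ?case by (simp add: mspan.zero)
  next
    case (step c x s)
    then obtain j where j: "j < n" "x = p [^]\<^bsub>P\<^esub> j" by auto
    have cc: "c \<in> carrier P" "\<And>k. coeff P c k \<in> I k" using step by (auto simp: rees_algebra_iff[OF I])
    have sc: "s \<in> carrier P" using step P.mspan_closed[OF A Xc] by blast
    have "monom P (coeff P (c \<otimes>\<^bsub>P\<^esub> x) k) k = (\<Oplus>\<^bsub>P\<^esub>i\<in>{..k}. monom P (coeff P c i) i \<otimes>\<^bsub>P\<^esub> f j (k - i))"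
      unfolding f_def j using monom_coeff_mult[OF cc(1) pc] .
    also have "\<dots> \<in> mspan P (rees_algebra R I) F"
    proof (rule P.mspan_finsum[OF A Fc])
      fix i
      have "f j (k - i) \<in> F" using j by (auto simp: F_def)
      then show "monom P (coeff P c i) i \<otimes>\<^bsub>P\<^esub> f j (k - i) \<in> mspan P (rees_algebra R I) F"
        using monom_in_rees_algebra[OF I cc(2)]
        by (intro P.mspan_smult[OF A Fc] P.mspan_incl[OF A Fc])
    qed simp
    finally have "monom P (coeff P (c \<otimes>\<^bsub>P\<^esub> x) k) k \<oplus>\<^bsub>P\<^esub> monom P (coeff P s k) k
        \<in> mspan P (rees_algebra R I) F"
      using step by (intro P.mspan_add[OF A Fc])
    moreover have "monom P (coeff P (c \<otimes>\<^bsub>P\<^esub> x \<oplus>\<^bsub>P\<^esub> s) k) k =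
        monom P (coeff P (c \<otimes>\<^bsub>P\<^esub> x) k) k \<oplus>\<^bsub>P\<^esub> monom P (coeff P s k) k"
      using cc sc j pc by (simp del: coeff_mult)
    ultimately show ?case by simp
  qed
  show ?thesis
  proof (rule P.integral_over_components[OF A, where a = "\<lambda>k. monom P (coeff P p k) k"
        and f = f and n = n and p = "Suc (deg R p)" and E = E])
    show "monom P (coeff P p i) i \<in> carrier P" for i using p by simp
    show "monom P (coeff P p i) i = \<zero>\<^bsub>P\<^esub>" if "Suc (deg R p) \<le> i" for i
      using that p deg_aboveD[of p i] by simp
    show "f j k = \<zero>\<^bsub>P\<^esub>" if "j < n" "E \<le> k" for j k
    proof -
      have "deg R (p [^]\<^bsub>P\<^esub> j) < E"
        unfolding E_def using that by (intro le_imp_less_Suc Max_ge) auto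
      with that(2) have "deg R (p [^]\<^bsub>P\<^esub> j) < k" by simp
      then have "coeff P (p [^]\<^bsub>P\<^esub> j) k = \<zero>" using pc by (rule deg_aboveD)
      then show ?thesis by (simp add: f_def)
    qed
    show "f 0 0 = \<one>\<^bsub>P\<^esub>" by (simp add: f_def)
    show "f (Suc j) = conv P (\<lambda>k. monom P (coeff P p k) k) (f j)" for j
      unfolding conv_def f_def using monom_coeff_mult[OF p pc] p
      by (intro ext) (simp add: P.m_comm del: coeff_mult)
    show "f n k \<in> mspan P (rees_algebra R I) {f j k' |j k'. j < n}" for k
      using comp[OF pn] by (simp add: f_def F_def)
  qed (use fc n in auto)
qed

lemma integral_closure_rees_algebra_iff:
  assumes I: "filtration R I"
  shows "p \<in> integral_closure_in P (rees_algebra R I) \<longleftrightarrow>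
    p \<in> carrier P \<and> (\<forall>k. coeff P p k \<in> filt_integral_closure R I k)"
proof
  note A = rees_algebra_subring[OF I]
  assume "p \<in> integral_closure_in P (rees_algebra R I)"
  then have "p \<in> carrier P" "integral_over P (rees_algebra R I) p"
    using P.integral_closure_in_iff[OF A] by auto
  then show "p \<in> carrier P \<and> (\<forall>k. coeff P p k \<in> filt_integral_closure R I k)"
    using integral_over_monom_only_if[OF I] integral_over_homogeneous_component[OF I] by simp
next
  note A = rees_algebra_subring[OF I]
  assume p: "p \<in> carrier P \<and> (\<forall>k. coeff P p k \<in> filt_integral_closure R I k)"
  have "integral_over P (rees_algebra R I) (\<Oplus>\<^bsub>P\<^esub>i\<in>{..k}. monom P (coeff P p i) i)" for k
  proof (induction k)
    case 0
    then show ?case using p integral_over_monom_if[OF I] by simp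
  next
    case (Suc k)
    have "(\<Oplus>\<^bsub>P\<^esub>i\<in>{..Suc k}. monom P (coeff P p i) i) =
      monom P (coeff P p (Suc k)) (Suc k) \<oplus>\<^bsub>P\<^esub> (\<Oplus>\<^bsub>P\<^esub>i\<in>{..k}. monom P (coeff P p i) i)"
      using p by (intro P.finsum_Suc) auto
    moreover have "(\<Oplus>\<^bsub>P\<^esub>i\<in>{..k}. monom P (coeff P p i) i) \<in> carrier P"
      using p by (intro P.finsum_closed) auto
    ultimately show ?case
      using p Suc integral_over_monom_if[OF I] by (simp add: P.integral_over_add[OF A])
  qed
  then have "integral_over P (rees_algebra R I) p" using up_repr[of p] p by metis
  then show "p \<in> integral_closure_in P (rees_algebra R I)"
    using P.integral_closure_in_iff[OF A] p by blast
qed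

text \<open>Each L_m can be read off from the closure of the Rees algebra through its monomials of
  degree m, so the algebra and the filtration carry the same information.\<close>

lemma filt_integral_closure_eq_iff:
  assumes I: "filtration R I" and J: "filtration R J"
  shows "filt_integral_closure R I = filt_integral_closure R J \<longleftrightarrow>
    integral_closure_in P (rees_algebra R I) = integral_closure_in P (rees_algebra R J)"
proof
  assume "filt_integral_closure R I = filt_integral_closure R J"
  then show "integral_closure_in P (rees_algebra R I) = integral_closure_in P (rees_algebra R J)"
    by (simp add: set_eq_iff integral_closure_rees_algebra_iff[OF I] integral_closure_rees_algebra_iff[OF J])
next
  assume eq: "integral_closure_in P (rees_algebra R I) = integral_closure_in P (rees_algebra R J)"
  have iff: "f \<in> filt_integral_closure R H m \<longleftrightarrow>
      f \<in> carrier R \<and> monom P f m \<in> integral_closure_in P (rees_algebra R H)"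
    if H: "filtration R H" for f m H
    using integral_over_monom_if[OF H] integral_over_monom_only_if[OF H]
      R.filt_integral_closure_carrier[of H m] P.integral_closure_in_iff[OF rees_algebra_subring[OF H]]
    by auto
  show "filt_integral_closure R I = filt_integral_closure R J"
  proof (intro ext Set.set_eqI)
    show "f \<in> filt_integral_closure R I m \<longleftrightarrow> f \<in> filt_integral_closure R J m" for f m
      unfolding iff[OF I] iff[OF J] eq ..
  qed
qed

end

section \<open>The asymptotic Samuel function\<close>

text \<open>The indices m with f \<in> I_m form an initial segment containing 0, so their supremum
  cannot reach a finite m outside it.\<close>

lemma filt_order_ge_iff:
  assumes I: "filtration R I" and f: "f \<in> carrier R"
  shows "enat m \<le> filt_order I f \<longleftrightarrow> f \<in> I m"
proof
  assume "f \<in> I m"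
  then show "enat m \<le> filt_order I f" unfolding filt_order_def by (intro SUP_upper) simp
next
  assume m: "enat m \<le> filt_order I f"
  show "f \<in> I m"
  proof (rule ccontr)
    assume "f \<notin> I m"
    then have less: "k < m" if "f \<in> I k" for k
      using filtration_antimono[OF I, of m k] that by (meson linorder_not_less subsetD)
    then have "0 < m" using f filtration_0[OF I] by auto
    have "filt_order I f \<le> enat (m - 1)"
      unfolding filt_order_def using less by (intro SUP_least) force
    with m have "enat m \<le> enat (m - 1)" by (rule order_trans)
    with \<open>0 < m\<close> show False by simp
  qed
qed

text \<open>The witness \<open>q\<close> treats finite and infinite orders alike: it is the order
  itself in the first case and any sufficiently large number in the second.\<close>

lemma ennreal_less_enat_divide_iff:
  assumes "c \<ge> 0" "n > 0"
  shows "ennreal c < ennreal_of_enat k / of_nat n \<longleftrightarrow> (\<exists>q. c * real n < real q \<and> enat q \<le> k)"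
proof (cases k)
  case (enat j)
  have "ennreal_of_enat k / of_nat n = ennreal (real j / real n)"
    using assms enat by (simp add: divide_ennreal flip: ennreal_of_nat_eq_real_of_nat)
      (simp add: divide_ennreal ennreal_of_nat_eq_real_of_nat)
  then have "ennreal c < ennreal_of_enat k / of_nat n \<longleftrightarrow> c * real n < real j"
    using assms by (simp add: ennreal_less_iff field_simps)
  also have "\<dots> \<longleftrightarrow> (\<exists>q. c * real n < real q \<and> enat q \<le> k)"
    unfolding enat by (auto intro: less_le_trans)
  finally show ?thesis .
next
  case infinity
  have "ennreal_of_enat k / of_nat n = \<infinity>"
    using assms infinity by (simp add: ennreal_top_divide of_nat_less_top)
  then show ?thesis using reals_Archimedean2 infinity by auto
qed

lemma ennreal_leI_strict:
  assumes "\<And>c::real. c \<ge> 0 \<Longrightarrow> ennreal c < s \<Longrightarrow> ennreal c < t"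
  shows "s \<le> t"
proof (rule ccontr)
  assume "\<not> s \<le> t"
  then have "t < s" by simp
  then obtain c where "c \<ge> 0" "t = ennreal c" by (cases t) auto
  then show False using assms[of c] \<open>t < s\<close> by simp
qed

text \<open>Each hypothesis yields one inequality, the second after division by \<gamma>. As only
  finite test values c occur, infinite \<open>s\<close> and \<open>t\<close> are covered without a
  case distinction.\<close>

lemma ennreal_eq_mult_if_less:
  assumes g: "\<gamma> > 0" and "\<And>c. c \<ge> 0 \<Longrightarrow> ennreal c < s \<Longrightarrow> ennreal (c / \<gamma>) < t"
    and "\<And>c. c \<ge> 0 \<Longrightarrow> ennreal c < t \<Longrightarrow> ennreal (\<gamma> * c) < s"
  shows "s = ennreal \<gamma> * t"
proof (rule antisym)
  show "s \<le> ennreal \<gamma> * t"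
  proof (rule ennreal_leI_strict)
    fix c :: real assume c: "c \<ge> 0" "ennreal c < s"
    then have "ennreal \<gamma> * ennreal (c / \<gamma>) < ennreal \<gamma> * t"
      using g assms(2) by (intro ennreal_mult_strict_left_mono) auto
    then show "ennreal c < ennreal \<gamma> * t" using g c by (simp flip: ennreal_mult)
  qed
  have "t \<le> ennreal (1 / \<gamma>) * s"
  proof (rule ennreal_leI_strict)
    fix c :: real assume c: "c \<ge> 0" "ennreal c < t"
    then have "ennreal (1 / \<gamma>) * ennreal (\<gamma> * c) < ennreal (1 / \<gamma>) * s"
      using g assms(3) by (intro ennreal_mult_strict_left_mono) auto
    then show "ennreal c < ennreal (1 / \<gamma>) * s" using g c by (simp flip: ennreal_mult)
  qed
  then have "ennreal \<gamma> * t \<le> ennreal \<gamma> * (ennreal (1 / \<gamma>) * s)" by (rule mult_left_mono) simp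
  also have "\<dots> = s" using g by (simp flip: mult.assoc ennreal_mult)
  finally show "ennreal \<gamma> * t \<le> s" .
qed

text \<open>Rounding i/n down costs at most 1, hence at most q in the product. Such a constant loss
  disappears on division by a growing exponent.\<close>

lemma real_div_mult_ge: "n > 0 \<Longrightarrow> real i * (real q / real n) - real q \<le> real (i div n * q)"
proof -
  assume n: "n > 0"
  have "i < n + n * (i div n)" using n dividend_less_times_div by simp
  then have "real i < real n + real n * real (i div n)"
    by (metis of_nat_add of_nat_less_iff of_nat_mult)
  then have "real i / real n - 1 \<le> real (i div n)" using n by (simp add: field_simps)
  then have "(real i / real n - 1) * real q \<le> real (i div n) * real q" by (rule mult_right_mono) simp
  then show ?thesis by (simp add: algebra_simps)
qed

context cring
begin

lemma filtration_pow_div: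
  assumes I: "filtration R I" and x: "x \<in> carrier R" and "x [^] (n::nat) \<in> I q"
  shows "x [^] N \<in> I (N div n * q)"
proof -
  have "(x [^] n) [^] (N div n) \<in> I (q * (N div n))"
    by (rule filtration_pow[OF is_cring I assms(3)])
  moreover have "x [^] (N mod n) \<in> I 0" using filtration_0[OF I] x by simp
  ultimately have "(x [^] n) [^] (N div n) \<otimes> x [^] (N mod n) \<in> I (q * (N div n) + 0)"
    by (rule filtration_mult[OF I])
  then show ?thesis using x by (simp add: nat_pow_pow nat_pow_mult mult.commute)
qed

text \<open>A Fekete argument: if x^n \<in> I_q with q > cn, then x^N lies in I_s with s equal to q
  times the integer part of N/n, and the quotients s/N stay above c for large N. This also shows
  that the limit exists.\<close>

lemma asymptotic_samuel_eq_SUP: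
  assumes I: "filtration R I" and x: "x \<in> carrier R"
  shows "asymptotic_samuel R I x = (SUP n\<in>{1..}. ennreal_of_enat (filt_order I (x [^] n)) / of_nat n)"
    (is "_ = ?S")
proof -
  let ?v = "\<lambda>n::nat. ennreal_of_enat (filt_order I (x [^] n)) / of_nat n"
  have "?v \<longlonglongrightarrow> ?S"
  proof (rule order_tendstoI)
    fix a assume "a < ?S"
    then obtain n where n: "n \<ge> 1" "a < ?v n" by (auto simp: less_SUP_iff)
    then obtain c where c: "c \<ge> 0" "a = ennreal c" by (cases a) auto
    obtain q where q: "c * real n < real q" "x [^] n \<in> I q"
      using n c filt_order_ge_iff[OF I] x by (auto simp: ennreal_less_enat_divide_iff)
    \<comment> \<open>Beyond this bound the gain N(q/n - c) outweighs the rounding loss q.\<close>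
    obtain N0 where N0: "real q / (real q / real n - c) < real N0"
      using reals_Archimedean2 by blast
    have pos: "real q / real n - c > 0" using q n by (simp add: field_simps)
    have "a < ?v N" if N: "N \<ge> Suc N0" for N
    proof -
      have "real q / (real q / real n - c) < real N" using N0 N by linarith
      then have "real q < real N * (real q / real n - c)" using pos by (simp add: field_simps)
      then have "c * real N < real N * (real q / real n) - real q" by (simp add: algebra_simps)
      also have "\<dots> \<le> real (N div n * q)" using n by (intro real_div_mult_ge) simp
      finally have "c * real N < real (N div n * q)" .
      moreover have "enat (N div n * q) \<le> filt_order I (x [^] N)"
        using filtration_pow_div[OF I x q(2)] filt_order_ge_iff[OF I] x by simp
      ultimately show ?thesis unfolding c(2) using c N
        by (intro ennreal_less_enat_divide_iff[THEN iffD2] exI[of _ "N div n * q"] conjI) auto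
    qed
    then show "\<forall>\<^sub>F n in sequentially. a < ?v n" unfolding eventually_sequentially by blast
  next
    fix a assume a: "?S < a"
    have "?v n < a" if "n \<ge> 1" for n
    proof -
      have "?v n \<le> ?S" using that by (intro SUP_upper) auto
      then show ?thesis using a by (rule le_less_trans)
    qed
    then show "\<forall>\<^sub>F n in sequentially. ?v n < a" unfolding eventually_sequentially by blast
  qed
  then show ?thesis unfolding asymptotic_samuel_def by (rule limI)
qed

text \<open>A single power witnesses a strict lower bound because the limit is a supremum. For a
  weak bound such a witness need not exist.\<close>

lemma asymptotic_samuel_greater_iff:
  assumes I: "filtration R I" and x: "x \<in> carrier R" and c: "c \<ge> 0"
  shows "ennreal c < asymptotic_samuel R I x \<longleftrightarrow>
    (\<exists>n>0. \<exists>q. c * real n < real q \<and> x [^] n \<in> I q)"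
proof -
  have "ennreal c < asymptotic_samuel R I x \<longleftrightarrow>
      (\<exists>n\<in>{1..}. ennreal c < ennreal_of_enat (filt_order I (x [^] n)) / of_nat n)"
    unfolding asymptotic_samuel_eq_SUP[OF I x] by (rule less_SUP_iff)
  also have "\<dots> \<longleftrightarrow> (\<exists>n\<in>{1..}. \<exists>q. c * real n < real q \<and> x [^] n \<in> I q)"
    using c x by (intro bex_cong refl)
      (simp add: ennreal_less_enat_divide_iff filt_order_ge_iff[OF I])
  also have "\<dots> \<longleftrightarrow> (\<exists>n>0. \<exists>q. c * real n < real q \<and> x [^] n \<in> I q)"
    by (auto simp: Suc_le_eq)
  finally show ?thesis .
qed

text \<open>The shift \<open>n\<close> is what an integral equation leaves behind. It is independent
  of N and vanishes after division by the exponent rN.\<close>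

lemma asymptotic_samuel_ge:
  assumes I: "filtration R I" and x: "x \<in> carrier R" and r: "r > 0"
    and "\<And>N. x [^] (r * N) \<in> I (k * (N - n))" and c: "c * real r \<le> real k"
  shows "ennreal c \<le> asymptotic_samuel R I x"
proof (rule ennreal_leI_strict)
  fix t :: real assume t: "t \<ge> 0" "ennreal t < ennreal c"
  then have tc: "t < c" by (simp add: ennreal_less_iff)
  then have pos: "real k - t * real r > 0" using c r
    by (meson diff_gt_0_iff_gt less_le_trans mult_strict_right_mono of_nat_0_less_iff)
  obtain N0 where "real k * real n / (real k - t * real r) < real N0"
    using reals_Archimedean2 by blast
  then have "real k * real n < real N0 * (real k - t * real r)" using pos by (simp add: field_simps)
  \<comment> \<open>Above n, so that the truncated difference N - n is a genuine one, and positive,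
    so that rN is an admissible exponent.\<close>
  moreover define N where "N = N0 + n + 1"
  have "real N0 * (real k - t * real r) \<le> real N * (real k - t * real r)"
    using pos by (intro mult_right_mono) (auto simp: N_def)
  ultimately have "real k * real n < real N * (real k - t * real r)" by linarith
  moreover have "real (N - n) = real N - real n" by (simp add: N_def)
  ultimately have "t * real (r * N) < real (k * (N - n))" by (simp add: algebra_simps)
  moreover have "r * N > 0" using r by (simp add: N_def)
  ultimately show "ennreal t < asymptotic_samuel R I x"
    using assms(4) asymptotic_samuel_greater_iff[OF I x t(1)] by blast
qed

text \<open>An expansion that bypasses binomial coefficients: the factors f + g are distributed one
  at a time over a monomial f^i g^j until its degree is N.\<close>

lemma add_pow_in_ideal:
  assumes U: "ideal U R" and f: "f \<in> carrier R" and g: "g \<in> carrier R"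
    and "\<And>i j. i + j = N \<Longrightarrow> f [^] i \<otimes> g [^] j \<in> U"
  shows "(f \<oplus> g) [^] (N::nat) \<in> U"
proof -
  have "(f \<oplus> g) [^] n \<otimes> (f [^] i \<otimes> g [^] j) \<in> U" if "n + i + j = N" for n i j :: nat
    using that
  proof (induction n arbitrary: i j)
    case 0
    then show ?case using assms by simp
  next
    case (Suc n)
    have "(f \<oplus> g) [^] Suc n \<otimes> (f [^] i \<otimes> g [^] j) =
        (f \<oplus> g) [^] n \<otimes> (f [^] Suc i \<otimes> g [^] j) \<oplus> (f \<oplus> g) [^] n \<otimes> (f [^] i \<otimes> g [^] Suc j)"
      using f g by (simp add: l_distr r_distr m_ac)
    moreover have "(f \<oplus> g) [^] n \<otimes> (f [^] Suc i \<otimes> g [^] j) \<in> U" using Suc.prems by (intro Suc.IH) simp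
    moreover have "(f \<oplus> g) [^] n \<otimes> (f [^] i \<otimes> g [^] Suc j) \<in> U" using Suc.prems by (intro Suc.IH) simp
    ultimately show ?case using additive_subgroup.a_closed[OF ideal.axioms(1)[OF U]] by simp
  qed
  from this[of N 0 0] show ?thesis using f g by simp
qed

text \<open>For sums, let q/n and p/k be slopes above c for f and g, and d the smaller one. Every
  monomial f^i g^j of degree N lies in I_s for some s \<ge> dN - (q + p), the subtracted constant
  being the rounding loss, and for large N this exceeds cN.\<close>

lemma asymptotic_samuel_ideal:
  assumes I: "filtration R I" and c: "c \<ge> 0"
  shows "ideal {f \<in> carrier R. ennreal c < asymptotic_samuel R I f} R"
proof -
  let ?U = "{f \<in> carrier R. ennreal c < asymptotic_samuel R I f}"
  note iff = asymptotic_samuel_greater_iff[OF I _ c]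
  have mult: "r \<otimes> f \<in> ?U" if f: "f \<in> ?U" and r: "r \<in> carrier R" for r f
  proof -
    obtain n q where nq: "n > 0" "c * real n < real q" "f [^] n \<in> I q" using f iff by blast
    have "(r \<otimes> f) [^] n = r [^] n \<otimes> f [^] n" using r f by (simp add: nat_pow_distrib)
    also have "\<dots> \<in> I q" using nq(3) r by (intro ideal.I_l_closed[OF filtration_ideal[OF I]]) auto
    finally show ?thesis using nq f r iff[of "r \<otimes> f"] by auto
  qed
  have add: "f \<oplus> g \<in> ?U" if f: "f \<in> ?U" and g: "g \<in> ?U" for f g
  proof -
    have fg: "f \<in> carrier R" "g \<in> carrier R" using f g by auto
    obtain n q where nq: "n > 0" "c * real n < real q" "f [^] n \<in> I q" using f iff by blast
    obtain k p where kp: "k > 0" "c * real k < real p" "g [^] k \<in> I p" using g iff by blast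
    define d where "d = min (real q / real n) (real p / real k)"
    have d: "d > c" using nq kp by (simp add: d_def field_simps)
    define C where "C = real q + real p"
    obtain N where N: "C / (d - c) < real N" using reals_Archimedean2 by blast
    moreover have "C / (d - c) \<ge> 0" using d by (simp add: C_def)
    ultimately have N0: "N > 0" by linarith
    have N: "c * real N < d * real N - C" using N d by (simp add: field_simps)
    define Z where "Z = nat \<lceil>d * real N - C\<rceil>"
    have "(f \<oplus> g) [^] N \<in> I Z"
    proof (rule add_pow_in_ideal[OF filtration_ideal[OF I] fg])
      fix i j assume ij: "i + j = N"
      have "f [^] i \<otimes> g [^] j \<in> I (i div n * q + j div k * p)"
        by (intro filtration_mult[OF I] filtration_pow_div[OF I] fg nq kp)
      moreover have "Z \<le> i div n * q + j div k * p"
      proof -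
        have "d * real N - C = (real i * d - real q) + (real j * d - real p)"
          unfolding C_def ij[symmetric] by (simp add: algebra_simps)
        also have "\<dots> \<le> (real i * (real q / real n) - real q) + (real j * (real p / real k) - real p)"
          by (intro add_mono diff_right_mono mult_left_mono) (auto simp: d_def)
        also have "\<dots> \<le> real (i div n * q) + real (j div k * p)"
          by (intro add_mono real_div_mult_ge nq kp)
        finally show ?thesis unfolding Z_def by linarith
      qed
      ultimately show "f [^] i \<otimes> g [^] j \<in> I Z" using filtration_antimono[OF I] by blast
    qed
    moreover have "c * real N < real Z" using N unfolding Z_def by linarith
    ultimately show ?thesis using iff[of "f \<oplus> g"] fg N0 by auto
  qed
  \<comment> \<open>Zero lies in every ideal of the filtration, so any index above c is a witness;
    the added 1 makes the inequality strict.\<close>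
  have "\<zero> [^] (1::nat) \<in> I (nat \<lceil>c\<rceil> + 1)" using filtration_zero[OF I] by simp
  moreover have "c * real (1::nat) < real (nat \<lceil>c\<rceil> + 1)" using c by simp linarith
  ultimately have zero: "\<zero> \<in> ?U" using iff[of \<zero>] by (metis (mono_tags, lifting) mem_Collect_eq zero_closed zero_less_one)
  have uminus: "\<ominus> f \<in> ?U" if "f \<in> ?U" for f
    using mult[OF that, of "\<ominus> \<one>"] that by (simp add: l_minus)
  show ?thesis
  proof (rule idealI[OF ring_axioms])
    show "subgroup ?U (add_monoid R)"
      by (rule add.subgroupI) (use zero uminus add in \<open>auto simp flip: a_inv_def\<close>)
    show "x \<otimes> a \<in> ?U" "a \<otimes> x \<in> ?U" if "a \<in> ?U" "x \<in> carrier R" for a x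
      using mult[OF that] that by (auto simp: m_comm)
  qed
qed

section \<open>Integral closures of twists compared with \<nu>\<close>

lemma subset_ideal_integral_closure:
  assumes K: "ideal K R" and f: "f \<in> K"
  shows "f \<in> ideal_integral_closure R K"
proof -
  have fc: "f \<in> carrier R" using ideal.Icarr[OF K f] .
  have "\<ominus> f \<in> K [^]\<^bsub>ideals_set R\<^esub> (1::nat)"
    using f unfolding ideal_pow_1[OF K]
    by (rule additive_subgroup.a_inv_closed[OF ideal.axioms(1)[OF K]])
  moreover have "f [^] (1::nat) \<oplus> (\<Oplus>i\<in>{1..1::nat}. (\<ominus> f) \<otimes> f [^] (1 - i)) = \<zero>"
    using fc by (simp add: r_neg)
  ultimately show ?thesis unfolding ideal_integral_closure_def using fc
    by (intro CollectI conjI exI[of _ "1::nat"] exI[of _ "\<lambda>_. \<ominus> f"]) auto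
qed

text \<open>Rewriting g^n by its equation trades i factors g for a coefficient in I_(ki). Each
  factor g thus counts for k, except for at most n of them.\<close>

lemma ideal_integral_closure_pow:
  assumes I: "filtration R I" and g: "g \<in> ideal_integral_closure R (I k)"
  shows "\<exists>n. \<forall>N. g [^] (N::nat) \<in> I (k * (N - n))"
proof -
  obtain n a where gc: "g \<in> carrier R" and a: "\<forall>i\<in>{1..n::nat}. a i \<in> I k [^]\<^bsub>ideals_set R\<^esub> i"
    and eq: "g [^] n \<oplus> (\<Oplus>i\<in>{1..n}. a i \<otimes> g [^] (n - i)) = \<zero>"
    using g unfolding ideal_integral_closure_def by blast
  have ai: "a i \<in> I (k * i)" if "i \<in> {1..n}" for i
    using a that ideal_pow_subset_filtration[OF I] by blast
  have ac: "a i \<in> carrier R" if "i \<in> {1..n}" for i using ai[OF that] by (rule filtration_carrier[OF I])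
  define S where "S = (\<Oplus>i\<in>{1..n}. a i \<otimes> g [^] (n - i))"
  have Sc: "S \<in> carrier R" unfolding S_def using ac gc by (intro finsum_closed) auto
  have gn: "g [^] n = \<ominus> S" using eq Sc gc unfolding S_def[symmetric] by (intro sum_zero_eq_neg) auto
  have "g [^] N \<in> I (k * (N - n))" for N :: nat
  proof (induction N rule: less_induct)
    case (less N)
    show ?case
    proof (cases "n \<le> N")
      case False
      then show ?thesis using filtration_0[OF I] gc by simp
    next
      case True
      have id: "ideal (I (k * (N - n))) R" by (rule filtration_ideal[OF I])
      have "g [^] (N - n) \<otimes> S = (\<Oplus>i\<in>{1..n}. g [^] (N - n) \<otimes> (a i \<otimes> g [^] (n - i)))"
        unfolding S_def by (rule finsum_rdistr) (use ac gc in auto)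
      also have "\<dots> \<in> I (k * (N - n))"
      proof (rule ideal_finsum_closed[OF id])
        fix i assume i: "i \<in> {1..n}"
        have "g [^] (N - n) \<otimes> (a i \<otimes> g [^] (n - i)) = a i \<otimes> (g [^] (N - n) \<otimes> g [^] (n - i))"
          using ac[OF i] gc by (simp add: m_lcomm)
        also have "g [^] (N - n) \<otimes> g [^] (n - i) = g [^] (N - i)"
          using i True gc by (simp add: nat_pow_mult)
        \<comment> \<open>If N - i < n, the second summand is truncated to 0, but then ki alone is
          at least k(N - n).\<close>
        also have "a i \<otimes> g [^] (N - i) \<in> I (k * i + k * (N - i - n))"
          using i True by (intro filtration_mult[OF I] ai less.IH) auto
        also have "I (k * i + k * (N - i - n)) \<subseteq> I (k * (N - n))"
          by (rule filtration_antimono[OF I], subst distrib_left[symmetric], rule mult_le_mono2) simp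
        finally show "g [^] (N - n) \<otimes> (a i \<otimes> g [^] (n - i)) \<in> I (k * (N - n))" .
      qed simp
      finally have "\<ominus> (g [^] (N - n) \<otimes> S) \<in> I (k * (N - n))"
        by (rule additive_subgroup.a_inv_closed[OF ideal.axioms(1)[OF id]])
      moreover have "g [^] N = g [^] (N - n) \<otimes> g [^] n" using True gc by (simp add: nat_pow_mult)
      then have "g [^] N = \<ominus> (g [^] (N - n) \<otimes> S)" unfolding gn using gc Sc by (simp add: r_minus)
      ultimately show ?thesis by simp
    qed
  qed
  then show ?thesis by blast
qed

lemma filtration_twist:
  assumes I: "filtration R I" and \<alpha>: "\<alpha> > 0"
  shows "filtration R (twist I \<alpha>)"
  unfolding filtration_def twist_def
proof (intro conjI allI)
  show "I (nat \<lceil>\<alpha> * real 0\<rceil>) = carrier R" using filtration_0[OF I] by simp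
  show "I (nat \<lceil>\<alpha> * real (Suc n)\<rceil>) \<subseteq> I (nat \<lceil>\<alpha> * real n\<rceil>)" for n
    using \<alpha> by (intro filtration_antimono[OF I] nat_mono ceiling_mono mult_left_mono) auto
  fix m n
  have "I (nat \<lceil>\<alpha> * real n\<rceil>) \<cdot> I (nat \<lceil>\<alpha> * real m\<rceil>) \<subseteq> I (nat \<lceil>\<alpha> * real n\<rceil> + nat \<lceil>\<alpha> * real m\<rceil>)"
    using I by (simp add: filtration_def)
  also have "\<dots> \<subseteq> I (nat \<lceil>\<alpha> * real (n + m)\<rceil>)"
  proof (rule filtration_antimono[OF I])
    have "0 \<le> \<alpha> * real n" "0 \<le> \<alpha> * real m" using \<alpha> by auto
    then show "nat \<lceil>\<alpha> * real (n + m)\<rceil> \<le> nat \<lceil>\<alpha> * real n\<rceil> + nat \<lceil>\<alpha> * real m\<rceil>"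
      by (simp add: distrib_left) linarith
  qed
  finally show "I (nat \<lceil>\<alpha> * real n\<rceil>) \<cdot> I (nat \<lceil>\<alpha> * real m\<rceil>) \<subseteq> I (nat \<lceil>\<alpha> * real (n + m)\<rceil>)" .
qed (rule filtration_ideal[OF I])

text \<open>With s the ceiling of \<alpha>rm, an integral equation for f^r over I_s puts f^(rN) into
  I_(s(N-n)). The slope s/r is at least \<alpha>m and the shift n is lost in the limit, which leaves
  a weak inequality only.\<close>

lemma filt_integral_closure_twist_ge:
  assumes I: "filtration R I" and f: "f \<in> filt_integral_closure R (twist I \<alpha>) m"
  shows "ennreal (\<alpha> * real m) \<le> asymptotic_samuel R I f"
proof -
  obtain r where fc: "f \<in> carrier R" and r: "r > (0::nat)"
    and fr: "f [^] r \<in> ideal_integral_closure R (I (nat \<lceil>\<alpha> * real (r * m)\<rceil>))"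
    using f unfolding filt_integral_closure_def twist_def by blast
  obtain n where n: "(f [^] r) [^] (N::nat) \<in> I (nat \<lceil>\<alpha> * real (r * m)\<rceil> * (N - n))" for N
    using ideal_integral_closure_pow[OF I fr] by blast
  show ?thesis
  proof (rule asymptotic_samuel_ge[OF I fc r])
    show "f [^] (r * N) \<in> I (nat \<lceil>\<alpha> * real (r * m)\<rceil> * (N - n))" for N
      using n[of N] fc by (simp add: nat_pow_pow)
    have "\<alpha> * real m * real r = \<alpha> * real (r * m)" by simp
    also have "\<dots> \<le> real (nat \<lceil>\<alpha> * real (r * m)\<rceil>)" by (rule real_nat_ceiling_ge)
    finally show "\<alpha> * real m * real r \<le> real (nat \<lceil>\<alpha> * real (r * m)\<rceil>)" .
  qed
qed

text \<open>A strict bound gives f^n \<in> I_q with q > \<alpha>mn. As q is an integer it is at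
  least the ceiling, so f^n lies in the twisted ideal of index nm itself and not merely in its
  integral closure.\<close>

lemma filt_integral_closure_twist_if_less:
  assumes I: "filtration R I" and f: "f \<in> carrier R" and \<alpha>: "\<alpha> > 0"
    and less: "ennreal (\<alpha> * real m) < asymptotic_samuel R I f"
  shows "f \<in> filt_integral_closure R (twist I \<alpha>) m"
proof -
  obtain n q where nq: "n > 0" "\<alpha> * real m * real n < real q" "f [^] n \<in> I q"
    using less asymptotic_samuel_greater_iff[OF I f, of "\<alpha> * real m"] \<alpha> by auto
  have "nat \<lceil>\<alpha> * real (n * m)\<rceil> \<le> q"
    using nq(2) by (simp add: nat_le_iff ceiling_le_iff mult_ac)
  then have "f [^] n \<in> twist I \<alpha> (n * m)"
    unfolding twist_def using nq(3) filtration_antimono[OF I] by blast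
  then have "f [^] n \<in> ideal_integral_closure R (twist I \<alpha> (n * m))"
    by (rule subset_ideal_integral_closure[OF filtration_ideal[OF filtration_twist[OF I \<alpha>]]])
  then show ?thesis unfolding filt_integral_closure_def using f nq(1) by blast
qed

lemma filt_integral_closure_0:
  assumes I: "filtration R I"
  shows "filt_integral_closure R I 0 = carrier R"
proof
  show "carrier R \<subseteq> filt_integral_closure R I 0"
  proof
    fix f assume f: "f \<in> carrier R"
    then have "f [^] (1::nat) \<in> I (1 * 0)" using filtration_0[OF I] by simp
    then have "f [^] (1::nat) \<in> ideal_integral_closure R (I (1 * 0))"
      by (rule subset_ideal_integral_closure[OF filtration_ideal[OF I]])
    then show "f \<in> filt_integral_closure R I 0" unfolding filt_integral_closure_def using f by blast
  qed
qed (rule filt_integral_closure_carrier)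

text \<open>Choose a rational m/p between c/\<alpha> and q/(n\<alpha>), where x^n \<in> I_q
  witnesses the bound. Then \<nu>_I(x^p) > \<alpha>m, so x^p lies in the closure of degree m and
  \<nu>_J(x^p) \<ge> \<beta>m; a witness for x^p is one for x with exponent multiplied by p.\<close>

lemma asymptotic_samuel_greater_if_closure_subset:
  assumes I: "filtration R I" and J: "filtration R J" and \<alpha>: "\<alpha> > 0" and \<beta>: "\<beta> > 0"
    and sub: "\<And>m. filt_integral_closure R (twist I \<alpha>) m \<subseteq> filt_integral_closure R (twist J \<beta>) m"
    and x: "x \<in> carrier R" and c: "c \<ge> 0" and less: "ennreal c < asymptotic_samuel R I x"
  shows "ennreal (\<beta> / \<alpha> * c) < asymptotic_samuel R J x"
proof -
  obtain n q where nq: "n > 0" "c * real n < real q" "x [^] n \<in> I q"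
    using less asymptotic_samuel_greater_iff[OF I x c] by blast
  have "c / \<alpha> < real q / (real n * \<alpha>)" using nq \<alpha> by (simp add: field_simps)
  then obtain s where s: "s \<in> \<rat>" "c / \<alpha> < s" "s < real q / (real n * \<alpha>)"
    using Rats_dense_in_real by blast
  moreover have "c / \<alpha> \<ge> 0" using c \<alpha> by simp
  ultimately have "s > 0" by linarith
  with s obtain m p where mp: "p \<noteq> 0" "\<bar>s\<bar> = real m / real p" using Rats_abs_nat_div_natE by metis
  have s_eq: "s = real m / real p" using mp(2) \<open>s > 0\<close> by simp
  have p: "p > 0" using mp by simp
  have m1: "c * real p < \<alpha> * real m" using s(2) p \<alpha> unfolding s_eq by (simp add: field_simps)
  have m2: "\<alpha> * real m * real n < real (q * p)"
    using s(3) p \<alpha> nq(1) unfolding s_eq by (simp add: field_simps)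
  have xp: "x [^] p \<in> carrier R" using x by simp
  have "(x [^] p) [^] n = (x [^] n) [^] p" using x by (simp add: nat_pow_pow mult.commute)
  also have "\<dots> \<in> I (q * p)" by (rule filtration_pow[OF is_cring I nq(3)])
  finally have "\<exists>n>0. \<exists>q. \<alpha> * real m * real n < real q \<and> (x [^] p) [^] n \<in> I q"
    using m2 nq(1) by blast
  then have "ennreal (\<alpha> * real m) < asymptotic_samuel R I (x [^] p)"
    using \<alpha> by (subst asymptotic_samuel_greater_iff[OF I xp]) auto
  then have "x [^] p \<in> filt_integral_closure R (twist J \<beta>) m"
    using filt_integral_closure_twist_if_less[OF I xp \<alpha>] sub by blast
  then have "ennreal (\<beta> * real m) \<le> asymptotic_samuel R J (x [^] p)"
    by (rule filt_integral_closure_twist_ge[OF J])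
  \<comment> \<open>The passage to J only gives a weak inequality; the room between cp and \<alpha>m
    makes it strict again.\<close>
  moreover have "ennreal (\<beta> / \<alpha> * c * real p) < ennreal (\<beta> * real m)"
  proof (rule ennreal_lessI)
    have "m > 0" using s_eq \<open>s > 0\<close> by (cases m) auto
    then show "0 < \<beta> * real m" using \<beta> by simp
    have "\<beta> / \<alpha> * (c * real p) < \<beta> / \<alpha> * (\<alpha> * real m)"
      using m1 \<alpha> \<beta> by (intro mult_strict_left_mono) auto
    then show "\<beta> / \<alpha> * c * real p < \<beta> * real m" using \<alpha> by (simp add: mult_ac)
  qed
  ultimately have "ennreal (\<beta> / \<alpha> * c * real p) < asymptotic_samuel R J (x [^] p)" by simp
  then obtain n' q' where n': "n' > 0" "\<beta> / \<alpha> * c * real p * real n' < real q'" "(x [^] p) [^] n' \<in> J q'"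
    using asymptotic_samuel_greater_iff[OF J xp, of "\<beta> / \<alpha> * c * real p"] \<alpha> \<beta> c by auto
  have "x [^] (p * n') \<in> J q'" using n'(3) x by (simp add: nat_pow_pow)
  moreover have "\<beta> / \<alpha> * c * real (p * n') < real q'" using n'(2) by (simp add: mult_ac)
  moreover have "p * n' > 0" using p n' by simp
  ultimately have "\<exists>n>0. \<exists>q. \<beta> / \<alpha> * c * real n < real q \<and> x [^] n \<in> J q" by blast
  then show ?thesis
    using \<alpha> \<beta> c by (subst asymptotic_samuel_greater_iff[OF J x]) auto
qed

lemma projectively_equivalent_if_closure_eq:
  assumes I: "filtration R I" and J: "filtration R J" and \<alpha>: "\<alpha> > 0" and \<beta>: "\<beta> > 0"
    and eq: "filt_integral_closure R (twist I \<alpha>) = filt_integral_closure R (twist J \<beta>)"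
  shows "projectively_equivalent R I J"
  unfolding projectively_equivalent_def
proof (intro exI[of _ "\<alpha> / \<beta>"] conjI ballI ennreal_eq_mult_if_less)
  fix x assume x: "x \<in> carrier R"
  show "ennreal (c / (\<alpha> / \<beta>)) < asymptotic_samuel R J x"
    if "c \<ge> 0" "ennreal c < asymptotic_samuel R I x" for c
    using asymptotic_samuel_greater_if_closure_subset[OF I J \<alpha> \<beta> _ x that] eq \<alpha> \<beta>
    by (simp add: mult.commute)
  show "ennreal (\<alpha> / \<beta> * c) < asymptotic_samuel R I x"
    if "c \<ge> 0" "ennreal c < asymptotic_samuel R J x" for c
    using asymptotic_samuel_greater_if_closure_subset[OF J I \<beta> \<alpha> _ x that] eq by simp
qed (use \<alpha> \<beta> in auto)

end

section \<open>Countability of the finite values and the choice of \<alpha>\<close>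

text \<open>The ascending chain condition makes the set of values well-ordered; only the gap above every
  real number is needed.\<close>

lemma asymptotic_samuel_gap:
  assumes "cring R" "noetherian_ring R" and I: "filtration R I" and c: "c \<ge> 0"
  shows "\<exists>d>c. \<forall>x\<in>carrier R. ennreal c < asymptotic_samuel R I x \<longrightarrow> ennreal d < asymptotic_samuel R I x"
proof -
  interpret cring R by fact
  interpret noetherian_ring R by fact
  define U where "U c = {f \<in> carrier R. ennreal c < asymptotic_samuel R I f}" for c
  have U: "ideal (U c) R" if "c \<ge> 0" for c unfolding U_def by (rule asymptotic_samuel_ideal[OF I that])
  obtain A where A: "A \<subseteq> carrier R" "finite A" "U c = Idl\<^bsub>R\<^esub> A" using finetely_gen[OF U[OF c]] by blast
  have "A \<subseteq> U c" using genideal_self[OF A(1)] A(3) by simp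
  \<comment> \<open>Each generator leaves some room above c, and finitely many generators leave a
    common amount of room.\<close>
  with A(2) have "\<exists>d>c. \<forall>a\<in>A. ennreal d < asymptotic_samuel R I a"
  proof (induction A rule: finite_induct)
    case empty
    then show ?case using gt_ex[of c] by auto
  next
    case (insert a A)
    then obtain d where d: "d > c" "\<forall>a\<in>A. ennreal d < asymptotic_samuel R I a" by auto
    have "ennreal c < asymptotic_samuel R I a" using insert.prems by (simp add: U_def)
    then obtain z where z: "ennreal c < z" "z < asymptotic_samuel R I a" using dense by blast
    then obtain e where e: "z = ennreal e" "e \<ge> 0" by (cases z) auto
    have "e > c" using z e c by (simp add: ennreal_less_iff)
    moreover have "ennreal (min d e) < asymptotic_samuel R I b" if "b \<in> insert a A" for b
    proof -
      have "ennreal d < asymptotic_samuel R I b \<or> ennreal e < asymptotic_samuel R I b"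
        using that d(2) z(2) e(1) by auto
      moreover have "ennreal (min d e) \<le> ennreal d" "ennreal (min d e) \<le> ennreal e"
        by (intro ennreal_leI; simp)+
      ultimately show ?thesis by (meson le_less_trans)
    qed
    ultimately show ?case using d(1) by (intro exI[of _ "min d e"]) auto
  qed
  then obtain d where d: "d > c" "\<forall>a\<in>A. ennreal d < asymptotic_samuel R I a" by blast
  \<comment> \<open>U d is an ideal containing the generators of U c, so every value above c is
    already above d.\<close>
  have "U c \<subseteq> U d" unfolding A(3)
    by (rule genideal_minimal[OF U]) (use d c A(1) in \<open>auto simp: U_def\<close>)
  then show ?thesis using d(1) by (intro exI[of _ d]) (auto simp: U_def)
qed

text \<open>A rational chosen in the gap above an element stays below all larger elements, so
  different elements receive different rationals.\<close>

lemma countable_if_gaps: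
  fixes V :: "real set"
  assumes "\<And>c. c \<in> V \<Longrightarrow> \<exists>d>c. \<forall>v\<in>V. c < v \<longrightarrow> d < v"
  shows "countable V"
proof -
  have "\<exists>s. s \<in> \<rat> \<and> c < s \<and> (\<forall>v\<in>V. c < v \<longrightarrow> s < v)" if c: "c \<in> V" for c
  proof -
    obtain d where "d > c" "\<forall>v\<in>V. c < v \<longrightarrow> d < v" using assms[OF c] by blast
    moreover from this(1) obtain s where "s \<in> \<rat>" "c < s" "s < d" using Rats_dense_in_real by blast
    ultimately show ?thesis by fastforce
  qed
  then obtain s where s: "\<And>c. c \<in> V \<Longrightarrow> s c \<in> \<rat> \<and> c < s c \<and> (\<forall>v\<in>V. c < v \<longrightarrow> s c < v)"
    by metis
  have "inj_on s V"
  proof (rule linorder_inj_onI')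
    fix i j assume "i \<in> V" "j \<in> V" "i < j"
    then have "s i < j" "j < s j" using s by blast+
    then show "s i \<noteq> s j" by simp
  qed
  moreover have "countable (s ` V)" using s by (intro countable_subset[OF _ countable_rat]) auto
  ultimately show ?thesis by (rule countable_image_inj_on[rotated])
qed

lemma closure_eq_if_projectively_equivalent:
  assumes R: "cring R" "noetherian_ring R" and I: "filtration R I" and J: "filtration R J"
    and "projectively_equivalent R I J"
  shows "\<exists>\<alpha> \<beta>::real. \<alpha> > 0 \<and> \<beta> > 0 \<and>
    filt_integral_closure R (twist I \<alpha>) = filt_integral_closure R (twist J \<beta>)"
proof -
  interpret cring R by fact
  obtain \<gamma> :: real where \<gamma>: "\<gamma> > 0" and
    eq: "\<And>x. x \<in> carrier R \<Longrightarrow> asymptotic_samuel R I x = ennreal \<gamma> * asymptotic_samuel R J x"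
    using assms(5) unfolding projectively_equivalent_def by blast
  define V where "V = {v. v \<ge> 0 \<and> (\<exists>x\<in>carrier R. asymptotic_samuel R I x = ennreal v)}"
  have "countable V"
  proof (rule countable_if_gaps)
    fix c assume "c \<in> V"
    then have c: "c \<ge> 0" by (simp add: V_def)
    obtain d where d: "d > c"
      "\<And>x. x \<in> carrier R \<Longrightarrow> ennreal c < asymptotic_samuel R I x \<Longrightarrow> ennreal d < asymptotic_samuel R I x"
      using asymptotic_samuel_gap[OF R I c] by blast
    have "d < v" if v: "v \<in> V" "c < v" for v
    proof -
      obtain x where x: "x \<in> carrier R" "asymptotic_samuel R I x = ennreal v" "v \<ge> 0"
        using v(1) by (auto simp: V_def)
      have "ennreal c < ennreal v" using v(2) c by (simp add: ennreal_less_iff)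
      then have "ennreal d < ennreal v" using d(2)[OF x(1)] x(2) by simp
      then show ?thesis using d(1) c by (simp add: ennreal_less_iff)
    qed
    then show "\<exists>d>c. \<forall>v\<in>V. c < v \<longrightarrow> d < v" using d(1) by blast
  qed
  \<comment> \<open>The forbidden \<alpha> are the quotients v/m of a value by a positive integer.
    There are countably many of them, so some number in the interval (0,1) remains.\<close>
  then have "countable (\<Union>m\<in>{1::nat..}. (\<lambda>v. v / real m) ` V)" by (intro countable_UN) auto
  then have "\<not> {0<..<1::real} \<subseteq> (\<Union>m\<in>{1::nat..}. (\<lambda>v. v / real m) ` V)"
    using uncountable_open_interval[of 0 "1::real"] countable_subset by auto
  then obtain \<alpha> :: real where "\<alpha> \<in> {0<..<1}" and
    avoid: "\<alpha> \<notin> (\<Union>m\<in>{1::nat..}. (\<lambda>v. v / real m) ` V)" by blast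
  then have \<alpha>: "\<alpha> > 0" by simp
  have V: "\<alpha> * real m \<notin> V" if "m \<ge> 1" for m
  proof
    assume "\<alpha> * real m \<in> V"
    then have "\<alpha> * real m / real m \<in> (\<Union>m\<in>{1::nat..}. (\<lambda>v. v / real m) ` V)" using that by blast
    then show False using avoid that by simp
  qed
  \<comment> \<open>Chosen so that \<alpha>m = \<gamma>(\<beta>m): ties for I at \<alpha>m are ties
    for J at \<beta>m, and one choice serves both filtrations.\<close>
  define \<beta> where "\<beta> = \<alpha> / \<gamma>"
  have \<beta>: "\<beta> > 0" using \<alpha> \<gamma> by (simp add: \<beta>_def)
  have scale: "ennreal (\<alpha> * real m) = ennreal \<gamma> * ennreal (\<beta> * real m)" for m
  proof -
    have "\<alpha> * real m = \<gamma> * (\<beta> * real m)" using \<gamma> by (simp add: \<beta>_def)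
    moreover have "ennreal (\<gamma> * (\<beta> * real m)) = ennreal \<gamma> * ennreal (\<beta> * real m)"
      using \<gamma> \<beta> by (intro ennreal_mult) auto
    ultimately show ?thesis by metis
  qed
  have "f \<in> filt_integral_closure R (twist I \<alpha>) m \<longleftrightarrow> f \<in> filt_integral_closure R (twist J \<beta>) m"
    if m: "m \<ge> 1" and f: "f \<in> carrier R" for f m
  proof -
    have ne: "asymptotic_samuel R I f \<noteq> ennreal (\<alpha> * real m)"
      using V[OF m] f \<alpha> unfolding V_def by auto
    then have ne': "asymptotic_samuel R J f \<noteq> ennreal (\<beta> * real m)"
      using eq[OF f] scale by auto
    have "f \<in> filt_integral_closure R (twist I \<alpha>) m \<longleftrightarrow> ennreal (\<alpha> * real m) < asymptotic_samuel R I f"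
      using filt_integral_closure_twist_ge[OF I] filt_integral_closure_twist_if_less[OF I f \<alpha>] ne
      by (metis order_le_less)
    also have "\<dots> \<longleftrightarrow> ennreal (\<beta> * real m) < asymptotic_samuel R J f"
    proof
      assume "ennreal (\<alpha> * real m) < asymptotic_samuel R I f"
      then show "ennreal (\<beta> * real m) < asymptotic_samuel R J f"
        unfolding eq[OF f] scale by (metis linorder_not_le mult_left_mono zero_le)
    next
      assume "ennreal (\<beta> * real m) < asymptotic_samuel R J f"
      then show "ennreal (\<alpha> * real m) < asymptotic_samuel R I f"
        unfolding eq[OF f] scale using \<gamma> by (intro ennreal_mult_strict_left_mono) auto
    qed
    also have "\<dots> \<longleftrightarrow> f \<in> filt_integral_closure R (twist J \<beta>) m"
      using filt_integral_closure_twist_ge[OF J] filt_integral_closure_twist_if_less[OF J f \<beta>] ne'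
      by (metis order_le_less)
    finally show ?thesis .
  qed
  then have "filt_integral_closure R (twist I \<alpha>) m = filt_integral_closure R (twist J \<beta>) m" for m
  proof (cases "m = 0")
    \<comment> \<open>In degree 0 the threshold \<alpha>m is 0 for every \<alpha>, so ties cannot be
      avoided there; both closures are the whole ring.\<close>
    case True
    then show ?thesis
      using filt_integral_closure_0 filtration_twist[OF I \<alpha>] filtration_twist[OF J \<beta>] by simp
  next
    case False
    assume *: "\<And>m f. 1 \<le> m \<Longrightarrow> f \<in> carrier R \<Longrightarrow>
      f \<in> filt_integral_closure R (twist I \<alpha>) m \<longleftrightarrow> f \<in> filt_integral_closure R (twist J \<beta>) m"
    have "m \<ge> 1" using False by simp
    then show ?thesis using *[of m] filt_integral_closure_carrier by blast
  qed
  then show ?thesis using \<alpha> \<beta> by blast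
qed

theorem theorem1p2:
  fixes R :: "('a, 'b) ring_scheme" and I J :: "nat \<Rightarrow> 'a set"
  assumes "cring R" and "noetherian_ring R"
    and "filtration R I" and "filtration R J"
  shows "(projectively_equivalent R I J \<longleftrightarrow>
            (\<exists>\<alpha> \<beta>::real. \<alpha> > 0 \<and> \<beta> > 0 \<and>
               filt_integral_closure R (twist I \<alpha>) = filt_integral_closure R (twist J \<beta>)))
       \<and> (projectively_equivalent R I J \<longleftrightarrow>
            (\<exists>\<alpha> \<beta>::real. \<alpha> > 0 \<and> \<beta> > 0 \<and>
               integral_closure_in (UP R) (rees_algebra R (twist I \<alpha>)) =
               integral_closure_in (UP R) (rees_algebra R (twist J \<beta>))))
       \<and> (\<forall>\<alpha> \<beta>::real. \<alpha> > 0 \<longrightarrow> \<beta> > 0 \<longrightarrow>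
            (filt_integral_closure R (twist I \<alpha>) = filt_integral_closure R (twist J \<beta>) \<longleftrightarrow>
             integral_closure_in (UP R) (rees_algebra R (twist I \<alpha>)) =
             integral_closure_in (UP R) (rees_algebra R (twist J \<beta>))))"
proof -
  interpret cring R by fact
  interpret UP_cring R "UP R" by unfold_locales simp
  have rees: "filt_integral_closure R (twist I \<alpha>) = filt_integral_closure R (twist J \<beta>) \<longleftrightarrow>
      integral_closure_in (UP R) (rees_algebra R (twist I \<alpha>)) =
      integral_closure_in (UP R) (rees_algebra R (twist J \<beta>))"
    if "\<alpha> > 0" "\<beta> > 0" for \<alpha> \<beta> :: real
    using filt_integral_closure_eq_iff cring.filtration_twist[OF assms(1)] assms(3,4) that by simp
  have main: "projectively_equivalent R I J \<longleftrightarrow>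
      (\<exists>\<alpha> \<beta>::real. \<alpha> > 0 \<and> \<beta> > 0 \<and>
         filt_integral_closure R (twist I \<alpha>) = filt_integral_closure R (twist J \<beta>))"
    using closure_eq_if_projectively_equivalent[OF assms]
      cring.projectively_equivalent_if_closure_eq[OF assms(1,3,4)] by blast
  show ?thesis using main rees by blast
qed

end
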